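(* Let $d\in\mathbb{N}$ and $p\in(1,2)$, and let $p'$ be given by $\frac1p+\frac1{p'}=1$. Then the Fourier transform $$\mathscr{F}: L^p(\mathbb{R}^d)\to L^{p',p}(\mathbb{R}^d)$$ is not strictly singular.
   Context: Let $\mu$ be $d$-dimensional Lebesgue measure on $\mathbb{R}^d$. $L^p(\mathbb{R}^d)$ is the usual Lebesgue space (functions identified a.e.) with norm $\|f\|_p=(\int_{\mathbb{R}^d}|f(x)|^p\,dx)^{1/p}$. For a measurable function $f$ on $\mathbb{R}^d$, its nonincreasing rearrangement is $f^*(t)=\inf\{\tau>0 : \mu\{x\in\mathbb{R}^d : |f(x)|>\tau\}\le t\}$, $t>0$. For $r,s\in(0,\infty)$ put $$\|f\|_{r,s}=\Big(\int_0^\infty \big(t^{1/r}f^*(t)\big)^s\,\frac{dt}{t}\Big)^{1/s},$$ and let the Lorentz space $L^{r,s}(\mathbb{R}^d)$ be the set of all measurable $f$ (identified a.e.) with $\|f\|_{r,s}<\infty$. For $1<p<2$ the functional $\|\cdot\|_{p',p}$ is a norm. Functions are complex-valued. The Fourier transform of $f\in L^1(\mathbb{R}^d)$ is $\mathscr{F}(f)(x)=\int_{\mathbb{R}^d} f(t)e^{-i\langle x,t\rangle}\,dt$, with $\langle x,t\rangle=\sum_{k=1}^d x_kt_k$. It is well known that for $p\in(1,2)$ the Fourier transform extends (uniquely, from $L^1(\mathbb{R}^d)\cap L^p(\mathbb{R}^d)$) to a bounded linear operator $\mathscr{F}:L^p(\mathbb{R}^d)\to L^{p',p}(\mathbb{R}^d)$;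 this is the operator in the claim. A bounded linear operator $T:X\to Y$ between Banach spaces is strictly singular if it does not induce an isomorphism on any infinite-dimensional closed subspace of $X$; specifically, if for every infinite-dimensional closed subspace $E\subset X$ and every $\varepsilon>0$ there exists $x$ in the unit sphere of $E$ such that $\|T(x)\|_Y\le\varepsilon$. *)

theory Defs
  imports "HOL-Analysis.Analysis"
begin

text \<open>
  Lebesgue measurable functions \<open>\<real>\<^sup>d \<rightarrow> \<complex>\<close>, identified almost everywhere. The dimension is
  \<open>d = CARD('d)\<close>. \<open>L\<^sup>p\<close> and the Lorentz spaces are subsets of this one complex vector space.
\<close>

definition ae_eq :: "(real ^ 'd::finite \<Rightarrow> complex) \<Rightarrow> (real ^ 'd \<Rightarrow> complex) \<Rightarrow> bool" where
  "ae_eq f g \<longleftrightarrow> f \<in> borel_measurable lebesgue \<and> g \<in> borel_measurable lebesgue \<and>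
     (AE x in lebesgue. f x = g x)"

quotient_type 'd L0 = "real ^ 'd::finite \<Rightarrow> complex" / partial: ae_eq
proof (rule part_equivpI)
  show "\<exists>f. ae_eq f f"
    by (rule exI[of _ "\<lambda>_. 0"]) (simp add: ae_eq_def)
  show "symp ae_eq"
    by (auto simp: symp_def ae_eq_def)
  show "transp ae_eq"
    by (auto simp: transp_def ae_eq_def)
qed

instantiation L0 :: (finite) ab_group_add
begin

lift_definition zero_L0 :: "'a L0" is "\<lambda>_. 0"
  by (simp add: ae_eq_def)

lift_definition plus_L0 :: "'a L0 \<Rightarrow> 'a L0 \<Rightarrow> 'a L0" is "\<lambda>f g x. f x + g x"
  by (auto simp: ae_eq_def)

lift_definition uminus_L0 :: "'a L0 \<Rightarrow> 'a L0" is "\<lambda>f x. - f x"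
  by (auto simp: ae_eq_def)

lift_definition minus_L0 :: "'a L0 \<Rightarrow> 'a L0 \<Rightarrow> 'a L0" is "\<lambda>f g x. f x - g x"
  by (auto simp: ae_eq_def)

instance
proof
  fix a b c :: "'a L0"
  show "a + b + c = a + (b + c)" by transfer (auto simp: ae_eq_def add.assoc)
  show "a + b = b + a" by transfer (auto simp: ae_eq_def add.commute)
  show "0 + a = a" by transfer (auto simp: ae_eq_def)
  show "- a + a = 0" by transfer (auto simp: ae_eq_def)
  show "a - b = a + - b" by transfer (auto simp: ae_eq_def)
qed

end

lift_definition scaleC_L0 :: "complex \<Rightarrow> 'd::finite L0 \<Rightarrow> 'd L0" is "\<lambda>c f x. c * f x"
  by (auto simp: ae_eq_def)

global_interpretation L0: vector_space "scaleC_L0 :: complex \<Rightarrow> 'd::finite L0 \<Rightarrow> 'd L0"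
proof
  fix a b :: complex and x y :: "'d L0"
  show "scaleC_L0 a (x + y) = scaleC_L0 a x + scaleC_L0 a y"
    by transfer (auto simp: ae_eq_def algebra_simps)
  show "scaleC_L0 (a + b) x = scaleC_L0 a x + scaleC_L0 b x"
    by transfer (auto simp: ae_eq_def algebra_simps)
  show "scaleC_L0 a (scaleC_L0 b x) = scaleC_L0 (a * b) x"
    by transfer (auto simp: ae_eq_def algebra_simps)
  show "scaleC_L0 1 x = x"
    by transfer (auto simp: ae_eq_def)
qed

text \<open>
  Norms take values in \<open>[0, \<infinity>]\<close>; a space consists of the classes of finite norm.
  \<open>epowr x s\<close> is \<open>x\<^sup>s\<close> for \<open>x \<in> [0, \<infinity>]\<close> and \<open>s > 0\<close>.
\<close>

definition epowr :: "ennreal \<Rightarrow> real \<Rightarrow> ennreal" where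
  "epowr x s = (if x = \<infinity> then \<infinity> else ennreal (enn2real x powr s))"

lift_definition Lp_norm :: "real \<Rightarrow> 'd::finite L0 \<Rightarrow> ennreal" is
  "\<lambda>p f. epowr (\<integral>\<^sup>+ x. ennreal (cmod (f x) powr p) \<partial>lebesgue) (1 / p)"
proof -
  fix p :: real and f g :: "real ^ 'd \<Rightarrow> complex"
  assume "ae_eq f g"
  then have "(\<integral>\<^sup>+ x. ennreal (cmod (f x) powr p) \<partial>lebesgue) =
      (\<integral>\<^sup>+ x. ennreal (cmod (g x) powr p) \<partial>lebesgue)"
    by (intro nn_integral_cong_AE) (auto simp: ae_eq_def)
  then show "epowr (\<integral>\<^sup>+ x. ennreal (cmod (f x) powr p) \<partial>lebesgue) (1 / p) =
      epowr (\<integral>\<^sup>+ x. ennreal (cmod (g x) powr p) \<partial>lebesgue) (1 / p)"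
    by simp
qed

definition Lp :: "real \<Rightarrow> 'd::finite L0 set" where
  "Lp p = {f. Lp_norm p f < \<infinity>}"

text \<open>The infimum is taken in \<open>[0, \<infinity>]\<close>, so it is \<open>\<infinity>\<close> when no \<open>\<tau>\<close> qualifies.\<close>

lift_definition rearrangement :: "'d::finite L0 \<Rightarrow> real \<Rightarrow> ennreal" is
  "\<lambda>f t. Inf {ennreal \<tau> | \<tau>. \<tau> > 0 \<and> emeasure lebesgue {x. cmod (f x) > \<tau>} \<le> ennreal t}"
proof -
  fix f g :: "real ^ 'd \<Rightarrow> complex"
  assume fg: "ae_eq f g"
  have "emeasure lebesgue {x. cmod (f x) > \<tau>} = emeasure lebesgue {x. cmod (g x) > \<tau>}" for \<tau>
  proof (rule emeasure_eq_AE)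
    have m: "f \<in> borel_measurable lebesgue" "g \<in> borel_measurable lebesgue"
      using fg by (auto simp: ae_eq_def)
    have "{x \<in> space lebesgue. cmod (f x) > \<tau>} \<in> sets lebesgue"
      "{x \<in> space lebesgue. cmod (g x) > \<tau>} \<in> sets lebesgue"
      using m by measurable
    then show "{x. cmod (f x) > \<tau>} \<in> sets lebesgue" "{x. cmod (g x) > \<tau>} \<in> sets lebesgue"
      by simp_all
    show "AE x in lebesgue. x \<in> {x. cmod (f x) > \<tau>} \<longleftrightarrow> x \<in> {x. cmod (g x) > \<tau>}"
      using fg by (auto simp: ae_eq_def)
  qed
  then show "(\<lambda>t. Inf {ennreal \<tau> | \<tau>. \<tau> > 0 \<and> emeasure lebesgue {x. cmod (f x) > \<tau>} \<le> ennreal t}) =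
      (\<lambda>t. Inf {ennreal \<tau> | \<tau>. \<tau> > 0 \<and> emeasure lebesgue {x. cmod (g x) > \<tau>} \<le> ennreal t})"
    by simp
qed

definition Lorentz_norm :: "real \<Rightarrow> real \<Rightarrow> 'd::finite L0 \<Rightarrow> ennreal" where
  "Lorentz_norm r s f =
     epowr (\<integral>\<^sup>+ t \<in> {0<..}. epowr (ennreal (t powr (1 / r)) * rearrangement f t) s * ennreal (1 / t)
              \<partial>lborel) (1 / s)"

definition Lorentz :: "real \<Rightarrow> real \<Rightarrow> 'd::finite L0 set" where
  "Lorentz r s = {f. Lorentz_norm r s f < \<infinity>}"

text \<open>Outside \<open>L\<^sup>1\<close> the Bochner integral below is \<open>0\<close> by convention, so the transform is meaningful
  only on \<open>Lp 1\<close>.\<close>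

definition fourier_integral :: "(real ^ 'd::finite \<Rightarrow> complex) \<Rightarrow> real ^ 'd \<Rightarrow> complex" where
  "fourier_integral f x = (LINT t|lebesgue. f t * exp (- \<i> * complex_of_real (x \<bullet> t)))"

lemma fourier_kernel_measurable [measurable]:
  "(\<lambda>t. exp (- \<i> * complex_of_real (x \<bullet> t))) \<in> borel_measurable lebesgue"
  for x :: "real ^ 'd::finite"
proof -
  have "(\<lambda>t. exp (- \<i> * complex_of_real (x \<bullet> t))) \<in> borel_measurable borel"
    by (intro borel_measurable_continuous_onI continuous_intros)
  then show ?thesis
    by (intro measurable_completion) simp
qed

lemma continuous_fourier_integral:
  fixes f :: "real ^ 'd::finite \<Rightarrow> complex"
  assumes f: "integrable lebesgue f"
  shows "continuous_on UNIV (fourier_integral f)"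
  unfolding continuous_on_sequentially
proof (intro allI ballI impI, elim conjE)
  fix u :: "nat \<Rightarrow> real ^ 'd" and a
  assume u: "u \<longlonglongrightarrow> a"
  have [measurable]: "f \<in> borel_measurable lebesgue"
    using f by auto
  show "(fourier_integral f \<circ> u) \<longlonglongrightarrow> fourier_integral f a"
    unfolding fourier_integral_def o_def
  proof (rule integral_dominated_convergence)
    show "integrable lebesgue (\<lambda>t. cmod (f t))"
      using f by (rule integrable_norm)
    show "AE t in lebesgue. (\<lambda>n. f t * exp (- \<i> * complex_of_real (u n \<bullet> t)))
        \<longlonglongrightarrow> f t * exp (- \<i> * complex_of_real (a \<bullet> t))"
      by (intro AE_I2 tendsto_intros u)
    show "AE t in lebesgue. cmod (f t * exp (- \<i> * complex_of_real (u n \<bullet> t))) \<le> cmod (f t)" for n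
      by (simp add: norm_mult norm_exp_eq_Re)
  qed measurable
qed

lemma fourier_integral_measurable:
  fixes f :: "real ^ 'd::finite \<Rightarrow> complex"
  assumes f [measurable]: "f \<in> borel_measurable lebesgue"
  shows "fourier_integral f \<in> borel_measurable lebesgue"
proof (cases "integrable lebesgue f")
  case True
  then have "fourier_integral f \<in> borel_measurable borel"
    by (intro borel_measurable_continuous_onI continuous_fourier_integral)
  then show ?thesis
    by (intro measurable_completion) simp
next
  case False
  have "\<not> integrable lebesgue (\<lambda>t. f t * exp (- \<i> * complex_of_real (x \<bullet> t)))" for x
  proof
    assume "integrable lebesgue (\<lambda>t. f t * exp (- \<i> * complex_of_real (x \<bullet> t)))"
    then have "integrable lebesgue f"
      by (rule Bochner_Integration.integrable_bound) (auto simp: norm_mult norm_exp_eq_Re)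
    with False show False ..
  qed
  then have "fourier_integral f = (\<lambda>_. 0)"
    unfolding fourier_integral_def by (intro ext not_integrable_integral_eq)
  then show ?thesis by simp
qed

lift_definition fourier_L1 :: "'d::finite L0 \<Rightarrow> 'd L0" is fourier_integral
proof -
  fix f g :: "real ^ 'd \<Rightarrow> complex"
  assume fg: "ae_eq f g"
  then have [measurable]: "f \<in> borel_measurable lebesgue" "g \<in> borel_measurable lebesgue"
    by (auto simp: ae_eq_def)
  have "fourier_integral f x = fourier_integral g x" for x
    unfolding fourier_integral_def
    using fg by (intro integral_cong_AE) (measurable, auto simp: ae_eq_def)
  then show "ae_eq (fourier_integral f) (fourier_integral g)"
    by (simp add: ae_eq_def fourier_integral_measurable)
qed

text \<open>
  Below, \<open>X\<close> and \<open>Y\<close> are linear subspaces of \<^typ>\<open>'d L0\<close> with norms \<open>nX\<close> and \<open>nY\<close>, finite on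
  \<open>X\<close> and \<open>Y\<close> respectively; only the values of \<open>T\<close> on \<open>X\<close> matter.
\<close>

definition bounded_linear_between ::
  "'d::finite L0 set \<Rightarrow> ('d L0 \<Rightarrow> ennreal) \<Rightarrow> 'd L0 set \<Rightarrow> ('d L0 \<Rightarrow> ennreal) \<Rightarrow> ('d L0 \<Rightarrow> 'd L0) \<Rightarrow> bool"
where
  "bounded_linear_between X nX Y nY T \<longleftrightarrow>
     (\<forall>f\<in>X. T f \<in> Y) \<and>
     (\<forall>f\<in>X. \<forall>g\<in>X. T (f + g) = T f + T g) \<and>
     (\<forall>c. \<forall>f\<in>X. T (scaleC_L0 c f) = scaleC_L0 c (T f)) \<and>
     (\<exists>C::real. \<forall>f\<in>X. nY (T f) \<le> ennreal C * nX f)"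

definition closed_subspace_of ::
  "'d::finite L0 set \<Rightarrow> 'd L0 set \<Rightarrow> ('d L0 \<Rightarrow> ennreal) \<Rightarrow> bool" where
  "closed_subspace_of E X nX \<longleftrightarrow>
     E \<subseteq> X \<and> L0.subspace E \<and>
     (\<forall>u f. (\<forall>n::nat. u n \<in> E) \<and> f \<in> X \<and> (\<lambda>n. nX (u n - f)) \<longlonglongrightarrow> 0 \<longrightarrow> f \<in> E)"

definition infinite_dimensional :: "'d::finite L0 set \<Rightarrow> bool" where
  "infinite_dimensional E \<longleftrightarrow> \<not> (\<exists>B. finite B \<and> E \<subseteq> L0.span B)"

text \<open>
  Boundedness and linearity of \<open>T\<close> are deliberately not part of this definition, so that its negation
  is not satisfied for the trivial reason that \<open>T\<close> is unbounded.
\<close>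

definition strictly_singular ::
  "'d::finite L0 set \<Rightarrow> ('d L0 \<Rightarrow> ennreal) \<Rightarrow> ('d L0 \<Rightarrow> ennreal) \<Rightarrow> ('d L0 \<Rightarrow> 'd L0) \<Rightarrow> bool"
where
  "strictly_singular X nX nY T \<longleftrightarrow>
     (\<forall>E. closed_subspace_of E X nX \<and> infinite_dimensional E \<longrightarrow>
        (\<forall>\<epsilon>::real. \<epsilon> > 0 \<longrightarrow> (\<exists>f\<in>E. nX f = 1 \<and> nY (T f) \<le> ennreal \<epsilon>)))"

text \<open>
  \<open>T\<close> is the extension of the Fourier transform from \<open>L\<^sup>1 \<inter> L\<^sup>p\<close> to a bounded linear operator
  \<open>L\<^sup>p \<rightarrow> L\<^sup>q\<^sup>,\<^sup>p\<close>; for \<open>1 < p < 2\<close> and \<open>q\<close> conjugate to \<open>p\<close> it exists and is unique on \<open>L\<^sup>p\<close>.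
\<close>

definition is_fourier_operator :: "real \<Rightarrow> real \<Rightarrow> ('d::finite L0 \<Rightarrow> 'd L0) \<Rightarrow> bool" where
  "is_fourier_operator p q T \<longleftrightarrow>
     bounded_linear_between (Lp p) (Lp_norm p) (Lorentz q p) (Lorentz_norm q p) T \<and>
     (\<forall>f \<in> Lp 1 \<inter> Lp p. T f = fourier_L1 f)"

end

theory Submission
  imports Defs
begin

text \<open>
  Let \<open>B\<^sub>n = (L\<^bsup>-n\<^esup>, 2 L\<^bsup>-n\<^esup>)\<^sup>d\<close> for a large constant \<open>L\<close>, and let \<open>E\<close> consist of the \<open>f = \<Sum> a\<^sub>n 1\<^bsub>B\<^sub>n\<^esub>\<close>
  in \<open>L\<^sup>p\<close>. The \<open>B\<^sub>n\<close> are disjoint, so \<open>E\<close> is a copy of \<open>\<ell>\<^sup>p\<close>; they lie in a bounded set, so \<open>E \<subseteq> L\<^sup>1\<close> and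
  the operator is given by the Fourier integral on \<open>E\<close>. On the box \<open>(L\<^sup>n, 2 L\<^sup>n)\<^sup>d\<close> the
  transform of \<open>1\<^bsub>B\<^sub>m\<^esub>\<close> is of full size for \<open>m = n\<close>; for \<open>m < n\<close> it is small by oscillation, and for
  \<open>m > n\<close> because \<open>B\<^sub>m\<close> has small measure. After normalization the transform is therefore a perturbation
  of a diagonal operator with off-diagonal entries decaying like \<open>r\<^bsup>2|m - n|\<^esup>\<close>, where \<open>r \<rightarrow> 0\<close> as
  \<open>L \<rightarrow> \<infinity>\<close>. The range \<open>L\<^bsup>nd\<^esup>/2 \<le> t < L\<^bsup>nd\<^esup>\<close> in the Lorentz norm sees the \<open>n\<close>-th box, so that norm
  dominates the \<open>\<ell>\<^sup>p\<close> norm of \<open>a\<close>.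
\<close>

subsection \<open>Perturbation of the diagonal on sequences\<close>

text \<open>
  The kernel used below is \<open>(off_diag r n m)\<^sup>2\<close>: one factor \<open>off_diag r n m\<close> makes the \<open>m\<close>-th term smaller
  than the \<open>p\<close>-th root of the weighted sum of the \<open>p\<close>-th powers, the other one is summed, which replaces
  Young's inequality.
\<close>

definition off_diag :: "real \<Rightarrow> nat \<Rightarrow> nat \<Rightarrow> real" where
  "off_diag r n m = (if m = n then 0 else r ^ ((m - n) + (n - m)))"

lemma off_diag_commute: "off_diag r n m = off_diag r m n"
  by (simp add: off_diag_def add.commute)

lemma off_diag_nonneg: "0 \<le> r \<Longrightarrow> 0 \<le> off_diag r n m"
  by (simp add: off_diag_def)

lemma off_diag_le_1: "0 \<le> r \<Longrightarrow> r \<le> 1 \<Longrightarrow> off_diag r n m \<le> 1"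
  by (simp add: off_diag_def power_le_one)

text \<open>Each side of the diagonal contributes part of the geometric series r + r^2 + ..., which
  is at most 2 r for r \<le> 1/2. That the bound is linear in \<open>r\<close> is what later makes
  the perturbation small.\<close>

lemma sum_off_diag_le:
  assumes "0 \<le> r" "r \<le> 1 / 2"
  shows "(\<Sum>m<N. off_diag r n m) \<le> 4 * r"
proof -
  have geom: "(\<Sum>k<K. r ^ Suc k) \<le> 2 * r" for K
  proof -
    have "(\<Sum>k<K. r ^ k) \<le> (\<Sum>k. r ^ k)"
      using assms by (intro sum_le_suminf summable_geometric) auto
    also have "\<dots> = 1 / (1 - r)"
      using assms by (intro suminf_geometric) auto
    also have "\<dots> \<le> 2"
      using assms by (simp add: field_simps)
    finally have "r * (\<Sum>k<K. r ^ k) \<le> r * 2"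
      using assms(1) by (rule mult_left_mono)
    then show ?thesis
      by (simp add: sum_distrib_left mult.commute)
  qed
  \<comment> \<open>Enlarging the range past \<open>n\<close> allows a split there; the term at
    \<open>n\<close> itself is zero and drops out of the upper half.\<close>
  have "(\<Sum>m<N. off_diag r n m) \<le> (\<Sum>m<n + Suc N. off_diag r n m)"
    using assms by (intro sum_mono2) (auto simp: off_diag_nonneg)
  also have "\<dots> = (\<Sum>m<n. off_diag r n m) + (\<Sum>m<Suc N. off_diag r n (n + m))"
    by (induction N) (auto simp: add.assoc)
  also have "(\<Sum>m<Suc N. off_diag r n (n + m)) = (\<Sum>k<N. r ^ Suc k)"
    by (subst sum.lessThan_Suc_shift) (simp add: off_diag_def)
  also have "(\<Sum>m<n. off_diag r n m) = (\<Sum>m<n. r ^ (n - m))"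
    by (intro sum.cong) (auto simp: off_diag_def)
  also have "\<dots> = (\<Sum>m<n. r ^ Suc (n - Suc m))"
    by (intro sum.cong) (auto simp: Suc_diff_Suc)
  also have "\<dots> = (\<Sum>k<n. r ^ Suc k)"
    by (rule sum.nat_diff_reindex)
  finally show ?thesis
    using geom[of n] geom[of N] by linarith
qed

lemma summable_off_diag:
  assumes "0 \<le> r" "r \<le> 1 / 2"
  shows "summable (off_diag r n)"
  using assms sum_off_diag_le[OF assms] off_diag_nonneg
  by (intro summableI_nonneg_bounded[where x = "4 * r"]) auto

lemma suminf_off_diag_le:
  assumes "0 \<le> r" "r \<le> 1 / 2"
  shows "(\<Sum>m. off_diag r n m) \<le> 4 * r"
  using summable_off_diag[OF assms] sum_off_diag_le[OF assms] by (intro suminf_le_const)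

text \<open>The sum is at most twice the maximum. This crude bound serves both the sequence estimate
  and the closure of \<open>Lp p\<close> under addition.\<close>

lemma add_powr_le:
  fixes x y p :: real
  assumes "0 \<le> x" "0 \<le> y" "0 \<le> p"
  shows "(x + y) powr p \<le> 2 powr p * (x powr p + y powr p)"
proof -
  have "(x + y) powr p \<le> (2 * max x y) powr p"
    using assms by (intro powr_mono2) auto
  also have "\<dots> = 2 powr p * max x y powr p"
    using assms by (simp add: powr_mult)
  also have "max x y powr p \<le> x powr p + y powr p"
    by (auto simp: max_def)
  finally show ?thesis
    by simp
qed

lemma le_suminf_powr:
  fixes b :: "nat \<Rightarrow> real"
  assumes "1 \<le> p" and b: "\<And>n. 0 \<le> b n" and sum: "summable (\<lambda>n. b n powr p)"
  shows "b m \<le> (\<Sum>n. b n powr p) powr (1 / p)"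
proof -
  have "b m powr p \<le> (\<Sum>n. b n powr p)"
    using sum_le_suminf[OF sum, of "{m}"] by simp
  then have "(b m powr p) powr (1 / p) \<le> (\<Sum>n. b n powr p) powr (1 / p)"
    using assms(1) by (intro powr_mono2) auto
  then show ?thesis
    using assms(1) b[of m] by (simp add: powr_powr)
qed

text \<open>Let D be the right-hand side of the last claim and w the weight. From 0 \<le> w \<le> 1
  and p \<ge> 1 follows (w b)^p \<le> w b^p \<le> D, so w b \<le> D^(1/p) termwise. Multiplying by
  the second factor w and summing costs only the total weight, and the same domination yields the
  first summability claim.\<close>

lemma off_diag_convolution_powr_le:
  fixes b :: "nat \<Rightarrow> real"
  assumes p: "1 \<le> p" and b: "\<And>n. 0 \<le> b n" and sum: "summable (\<lambda>n. b n powr p)"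
    and r: "0 \<le> r" "r \<le> 1 / 4"
  shows "summable (\<lambda>m. (off_diag r n m)\<^sup>2 * b m)"
    and "summable (\<lambda>m. off_diag r n m * b m powr p)"
    and "(\<Sum>m. (off_diag r n m)\<^sup>2 * b m) powr p \<le> (\<Sum>m. off_diag r n m * b m powr p)"
proof -
  let ?w = "off_diag r n"
  have r2: "r \<le> 1 / 2" and r1: "r \<le> 1" using r by auto
  note w0 = off_diag_nonneg[OF r(1), of n] and w1 = off_diag_le_1[OF r(1) r1, of n]
  define D where "D = (\<Sum>m. ?w m * b m powr p)"
  show D: "summable (\<lambda>m. ?w m * b m powr p)"
    by (rule summable_comparison_test'[OF sum, of 0]) (auto simp: w0 w1 mult_left_le_one_le)
  have D0: "0 \<le> D"
    unfolding D_def using D by (intro suminf_nonneg) (auto simp: w0)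
  have le: "?w m * b m \<le> D powr (1 / p)" for m
  proof -
    have "(?w m * b m) powr p = ?w m powr p * b m powr p"
      using w0 b by (simp add: powr_mult)
    also have "\<dots> \<le> ?w m powr 1 * b m powr p"
      using w0[of m] w1[of m] p by (intro mult_right_mono powr_mono') auto
    also have "\<dots> = ?w m * b m powr p"
      using w0[of m] by simp
    also have "\<dots> \<le> D"
      unfolding D_def using sum_le_suminf[OF D, of "{m}"] w0 by simp
    finally have "((?w m * b m) powr p) powr (1 / p) \<le> D powr (1 / p)"
      using p by (intro powr_mono2) auto
    then show ?thesis
      using p b[of m] w0[of m] by (simp add: powr_powr)
  qed
  have le': "(?w m)\<^sup>2 * b m \<le> ?w m * D powr (1 / p)" for m
    using mult_left_mono[OF le[of m] w0[of m]] by (simp add: power2_eq_square mult.assoc)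
  have s: "summable (\<lambda>m. ?w m * D powr (1 / p))"
    by (intro summable_mult2 summable_off_diag r r2)
  show s2: "summable (\<lambda>m. (?w m)\<^sup>2 * b m)"
    by (rule summable_comparison_test'[OF s, of 0]) (auto simp: w0 b intro: le')
  have "(\<Sum>m. (?w m)\<^sup>2 * b m) \<le> (\<Sum>m. ?w m * D powr (1 / p))"
    by (intro suminf_le le' s s2)
  also have "\<dots> = (\<Sum>m. ?w m) * D powr (1 / p)"
    by (intro suminf_mult2[symmetric] summable_off_diag r r2)
  \<comment> \<open>The total weight is at most 4 r, and r \<le> 1/4 brings this down to 1.\<close>
  also have "\<dots> \<le> 1 * D powr (1 / p)"
    using suminf_off_diag_le[OF r(1) r2, of n] r by (intro mult_right_mono) auto
  finally have "(\<Sum>m. (?w m)\<^sup>2 * b m) powr p \<le> (D powr (1 / p)) powr p"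
    using p by (intro powr_mono2 suminf_nonneg s2) (auto simp: b)
  then show "(\<Sum>m. (?w m)\<^sup>2 * b m) powr p \<le> D"
    using p D0 by (simp add: powr_powr)
qed

text \<open>After taking p-th powers and summing over n, the off-diagonal part contributes at most
  (2 C)^p * 4 r times the full sum S, hence at most S / 2 by \<open>small\<close>. Since S is finite
  by \<open>sum\<close>, this is absorbed on the left.\<close>

lemma diagonal_perturbation:
  fixes b G :: "nat \<Rightarrow> real"
  assumes p: "1 \<le> p" and b: "\<And>n. 0 \<le> b n" and sum: "summable (\<lambda>n. b n powr p)"
    and r: "0 \<le> r" "r \<le> 1 / 4" and G: "\<And>n. 0 \<le> G n" and C: "0 \<le> C"
    and small: "(2 * C) powr p * (4 * r) \<le> 1 / 2"
    and le: "\<And>n. b n \<le> C * (G n + (\<Sum>m. (off_diag r n m)\<^sup>2 * b m))"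
    and bd: "\<And>N. (\<Sum>n<N. G n powr p) \<le> \<gamma>"
  shows "(\<Sum>n. b n powr p) \<le> 2 * (2 * C) powr p * \<gamma>"
proof -
  define S where "S = (\<Sum>n. b n powr p)"
  define D where "D n = (\<Sum>m. off_diag r n m * b m powr p)" for n
  have S0: "0 \<le> S"
    unfolding S_def using sum by (intro suminf_nonneg) auto
  note conv = off_diag_convolution_powr_le[OF p b sum r]
  have bn: "b n powr p \<le> (2 * C) powr p * (G n powr p + D n)" for n
  proof -
    let ?s = "\<Sum>m. (off_diag r n m)\<^sup>2 * b m"
    have s0: "0 \<le> ?s"
      using conv(1) by (intro suminf_nonneg) (auto simp: b)
    have "b n powr p \<le> (C * (G n + ?s)) powr p"
      using b le p by (intro powr_mono2) auto
    also have "\<dots> = C powr p * (G n + ?s) powr p"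
      using C G s0 by (simp add: powr_mult)
    also have "(G n + ?s) powr p \<le> 2 powr p * (G n powr p + ?s powr p)"
      using G s0 p by (intro add_powr_le) auto
    also have "?s powr p \<le> D n"
      unfolding D_def by (rule conv)
    finally show ?thesis
      using C by (simp add: powr_mult mult.assoc mult_left_mono mult.left_commute)
  qed
  have Dsum: "(\<Sum>n<N. D n) \<le> 4 * r * S" for N
  proof -
    have "(\<Sum>n<N. D n) = (\<Sum>m. \<Sum>n<N. off_diag r n m * b m powr p)"
      unfolding D_def by (intro suminf_sum[symmetric] conv)
    also have "\<dots> \<le> (\<Sum>m. 4 * r * b m powr p)"
    proof (intro suminf_le summable_sum conv summable_mult sum)
      fix m
      \<comment> \<open>By symmetry of the kernel, the sum over \<open>n\<close> with
        \<open>m\<close> fixed is again one that \<open>sum_off_diag_le\<close> bounds.\<close>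
      have "(\<Sum>n<N. off_diag r n m * b m powr p) = (\<Sum>n<N. off_diag r m n) * b m powr p"
        by (simp add: sum_distrib_right off_diag_commute[of r m])
      also have "\<dots> \<le> 4 * r * b m powr p"
        using r by (intro mult_right_mono sum_off_diag_le) auto
      finally show "(\<Sum>n<N. off_diag r n m * b m powr p) \<le> 4 * r * b m powr p" .
    qed
    also have "\<dots> = 4 * r * S"
      unfolding S_def by (intro suminf_mult sum)
    finally show ?thesis .
  qed
  have "S \<le> (2 * C) powr p * \<gamma> + S / 2"
    unfolding S_def
  proof (rule suminf_le_const[OF sum], fold S_def)
    fix N
    have "(\<Sum>n<N. b n powr p) \<le> (\<Sum>n<N. (2 * C) powr p * (G n powr p + D n))"
      by (intro sum_mono bn)
    also have "\<dots> = (2 * C) powr p * ((\<Sum>n<N. G n powr p) + (\<Sum>n<N. D n))"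
      by (simp add: sum_distrib_left sum.distrib distrib_left)
    also have "\<dots> \<le> (2 * C) powr p * (\<gamma> + 4 * r * S)"
      by (intro mult_left_mono add_mono bd Dsum) auto
    also have "\<dots> = (2 * C) powr p * \<gamma> + (2 * C) powr p * (4 * r) * S"
      by (simp add: algebra_simps)
    also have "\<dots> \<le> (2 * C) powr p * \<gamma> + 1 / 2 * S"
      by (intro add_left_mono mult_right_mono small S0)
    finally show "(\<Sum>n<N. b n powr p) \<le> (2 * C) powr p * \<gamma> + S / 2" by simp
  qed
  then show ?thesis
    unfolding S_def by linarith
qed

subsection \<open>Fourier transforms of boxes\<close>

text \<open>Lebesgue measure on a Euclidean space is the image of a product measure under the map
  that assembles a vector from its coordinates, so Fubini applies.\<close>

lemma integral_lborel_prod: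
  fixes f :: "'a::euclidean_space \<Rightarrow> real \<Rightarrow> complex"
  assumes f: "\<And>b. b \<in> Basis \<Longrightarrow> integrable lborel (f b)"
  shows "(\<integral>x. (\<Prod>b\<in>Basis. f b (x \<bullet> b)) \<partial>lborel) = (\<Prod>b\<in>Basis. \<integral>t. f b t \<partial>lborel)"
proof -
  interpret product_sigma_finite "\<lambda>_::'a. lborel :: real measure" ..
  have [measurable]: "\<And>b. b \<in> Basis \<Longrightarrow> f b \<in> borel_measurable borel"
    using f by (auto dest: borel_measurable_integrable)
  have "(\<integral>x. (\<Prod>b\<in>Basis. f b (x \<bullet> b)) \<partial>lborel) =
      (\<integral>g. (\<Prod>b\<in>Basis. f b ((\<Sum>c\<in>Basis. g c *\<^sub>R c) \<bullet> b)) \<partial>(\<Pi>\<^sub>M b\<in>Basis. lborel))"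
    by (subst lborel_eq, subst integral_distr) simp_all
  also have "\<dots> = (\<integral>g. (\<Prod>b\<in>Basis. f b (g b)) \<partial>(\<Pi>\<^sub>M b\<in>Basis. lborel))"
    by simp
  also have "\<dots> = (\<Prod>b\<in>Basis. \<integral>t. f b t \<partial>lborel)"
    by (intro product_integral_prod f) auto
  finally show ?thesis .
qed

section \<open>Transforms of intervals on the line\<close>

definition interval_fourier :: "real \<Rightarrow> real \<Rightarrow> complex" where
  "interval_fourier s \<xi> =
    (\<integral>t. indicator {s<..<2 * s} t * exp (- \<i> * complex_of_real (\<xi> * t)) \<partial>lborel)"

lemma integrable_interval_fourier:
  "integrable lborel (\<lambda>t. indicator {s<..<2 * s} t * exp (- \<i> * complex_of_real (\<xi> * t)))"
proof (rule Bochner_Integration.integrable_bound)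
  show "integrable lborel (\<lambda>t. indicator {s<..<2 * s} t :: real)"
    \<comment> \<open>For \<open>s < 0\<close> the interval is empty.\<close>
    by (cases "0 \<le> s") (auto intro!: integrable_real_indicator)
  show "(\<lambda>t. indicator {s<..<2 * s} t * exp (- \<i> * complex_of_real (\<xi> * t))) \<in> borel_measurable lborel"
    by measurable
qed (auto simp: norm_mult split: split_indicator)

lemma norm_interval_fourier_le:
  assumes "0 \<le> s"
  shows "cmod (interval_fourier s \<xi>) \<le> s"
proof -
  have "cmod (interval_fourier s \<xi>) \<le> (\<integral>t. indicator {s<..<2 * s} t \<partial>lborel)"
    unfolding interval_fourier_def
  proof (rule Bochner_Integration.integral_norm_bound_integral)
    show "integrable lborel (\<lambda>t. indicator {s<..<2 * s} t :: real)"
      using assms by (auto intro!: integrable_real_indicator)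
  qed (use integrable_interval_fourier[of s \<xi>] in \<open>auto simp: norm_mult split: split_indicator\<close>)
  then show ?thesis
    using assms by simp
qed

text \<open>The exponential has an antiderivative of constant modulus 1 / \<xi>, and each endpoint
  contributes one such value.\<close>

lemma norm_interval_fourier_le_decay:
  assumes "0 \<le> s" "0 < \<xi>"
  shows "cmod (interval_fourier s \<xi>) \<le> 2 / \<xi>"
proof -
  define F where "F t = \<i> / \<xi> * exp (- \<i> * complex_of_real (\<xi> * t))" for t
  have "(\<integral>t. indicator {s..2 * s} t *\<^sub>R exp (- \<i> * complex_of_real (\<xi> * t)) \<partial>lborel) = F (2 * s) - F s"
  proof (rule integral_FTC_Icc)
    show "(F has_vector_derivative exp (- \<i> * complex_of_real (\<xi> * t))) (at t within {s..2 * s})" for t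
    proof -
      have "((\<lambda>z. \<i> / \<xi> * exp (- \<i> * (\<xi> * z))) has_field_derivative
          \<i> / \<xi> * (exp (- \<i> * (\<xi> * t)) * (- \<i> * \<xi>))) (at (complex_of_real t))"
        by (auto intro!: derivative_eq_intros simp: mult.commute[of _ \<i>])
      also have "\<i> / \<xi> * (exp (- \<i> * (\<xi> * t)) * (- \<i> * \<xi>)) = exp (- \<i> * complex_of_real (\<xi> * t))"
        using assms(2) by (simp add: mult.commute[of _ \<i>])
      finally show ?thesis
        unfolding F_def of_real_mult by (rule has_vector_derivative_real_field)
    qed
    show "continuous_on {s..2 * s} (\<lambda>t. exp (- \<i> * complex_of_real (\<xi> * t)))"
      by (intro continuous_intros)
  qed (use assms in auto)
  \<comment> \<open>The fundamental theorem speaks of the closed interval,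
    \<open>interval_fourier\<close> of the open one; the two endpoints are null sets.\<close>
  also have "(\<integral>t. indicator {s..2 * s} t *\<^sub>R exp (- \<i> * complex_of_real (\<xi> * t)) \<partial>lborel) = interval_fourier s \<xi>"
    unfolding interval_fourier_def
  proof (rule integral_cong_AE)
    show "AE t in lborel. indicator {s..2 * s} t *\<^sub>R exp (- \<i> * complex_of_real (\<xi> * t)) =
        indicator {s<..<2 * s} t * exp (- \<i> * complex_of_real (\<xi> * t))"
      using AE_lborel_singleton[of s] AE_lborel_singleton[of "2 * s"]
      by eventually_elim (auto split: split_indicator)
  qed measurable
  finally have "cmod (interval_fourier s \<xi>) \<le> cmod (F (2 * s)) + cmod (F s)"
    by (simp add: norm_triangle_ineq4)
  also have "\<dots> = 2 / \<xi>"
    using assms(2) by (simp add: F_def norm_mult norm_divide)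
  finally show ?thesis .
qed

text \<open>Multiplying by the phase at the midpoint 3 s / 2 leaves an argument of modulus at most
  \<xi> s / 2 \<le> 1 < pi / 3. The real part of the integrand is then at least 1/2 on an interval
  of length s.\<close>

lemma norm_interval_fourier_ge:
  assumes "0 < s" "0 \<le> \<xi>" "\<xi> \<le> 2 / s"
  shows "s / 2 \<le> cmod (interval_fourier s \<xi>)"
proof -
  let ?c = "exp (\<i> * complex_of_real (\<xi> * (3 / 2 * s)))"
  have "interval_fourier s \<xi> * ?c =
      (\<integral>t. indicator {s<..<2 * s} t * exp (- \<i> * complex_of_real (\<xi> * t)) * ?c \<partial>lborel)"
    unfolding interval_fourier_def by simp
  also have "(\<lambda>t. indicator {s<..<2 * s} t * exp (- \<i> * complex_of_real (\<xi> * t)) * ?c) =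
      (\<lambda>t. indicator {s<..<2 * s} t * cis (\<xi> * (3 / 2 * s - t)))"
    by (simp add: fun_eq_iff cis_conv_exp exp_add[symmetric] mult.assoc algebra_simps)
  finally have eq: "interval_fourier s \<xi> * ?c =
      (\<integral>t. indicator {s<..<2 * s} t * cis (\<xi> * (3 / 2 * s - t)) \<partial>lborel)" .
  have int: "integrable lborel (\<lambda>t. indicator {s<..<2 * s} t * cis (\<xi> * (3 / 2 * s - t)))"
  proof (rule Bochner_Integration.integrable_bound)
    show "integrable lborel (\<lambda>t. indicator {s<..<2 * s} t :: real)"
      using assms by (auto intro!: integrable_real_indicator)
    show "(\<lambda>t. indicator {s<..<2 * s} t * cis (\<xi> * (3 / 2 * s - t))) \<in> borel_measurable lborel"
      unfolding cis_conv_exp by measurable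
  qed (auto simp: norm_mult split: split_indicator)
  have cos: "1 / 2 \<le> cos (\<xi> * (3 / 2 * s - t))" if "s < t" "t < 2 * s" for t
  proof -
    have "\<bar>3 / 2 * s - t\<bar> \<le> s / 2"
      using that by linarith
    then have "\<bar>\<xi> * (3 / 2 * s - t)\<bar> \<le> 2 / s * (s / 2)"
      unfolding abs_mult using assms by (intro mult_mono) auto
    then have "\<bar>\<xi> * (3 / 2 * s - t)\<bar> \<le> pi / 3"
      using assms pi_gt3 by simp
    then have "cos (pi / 3) \<le> cos \<bar>\<xi> * (3 / 2 * s - t)\<bar>"
      by (intro cos_monotone_0_pi_le) auto
    then show ?thesis
      by (simp add: cos_60)
  qed
  have "s / 2 = (\<integral>t. 1 / 2 * indicator {s<..<2 * s} t \<partial>lborel)"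
    using assms by simp
  also have "\<dots> \<le> (\<integral>t. Re (indicator {s<..<2 * s} t * cis (\<xi> * (3 / 2 * s - t))) \<partial>lborel)"
  proof (rule integral_mono)
    show "integrable lborel (\<lambda>t. 1 / 2 * indicator {s<..<2 * s} t :: real)"
      using assms by (auto intro!: integrable_real_indicator)
    show "integrable lborel (\<lambda>t. Re (indicator {s<..<2 * s} t * cis (\<xi> * (3 / 2 * s - t))))"
      by (intro integrable_Re int)
    show "1 / 2 * indicator {s<..<2 * s} t \<le> Re (indicator {s<..<2 * s} t * cis (\<xi> * (3 / 2 * s - t)))" for t
      using cos by (auto split: split_indicator)
  qed
  also have "\<dots> = Re (interval_fourier s \<xi> * ?c)"
    using int unfolding eq by (rule integral_Re)
  also have "\<dots> \<le> cmod (interval_fourier s \<xi> * ?c)"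
    by (rule complex_Re_le_cmod)
  also have "\<dots> = cmod (interval_fourier s \<xi>)"
    by (simp add: norm_mult)
  finally show ?thesis .
qed

section \<open>Boxes as products of intervals\<close>

text \<open>One family serves on both sides: scales \<open>1 / L ^ n\<close> carry the step
  functions, scales \<open>L ^ n\<close> are where the transforms are tested. For positive scale the
  boxes stay away from the coordinate hyperplanes, as the decay estimate requires.\<close>

definition scale_box :: "real \<Rightarrow> 'a::euclidean_space set" where
  "scale_box s = box (s *\<^sub>R One) ((2 * s) *\<^sub>R One)"

lemma mem_scale_box: "x \<in> scale_box s \<longleftrightarrow> (\<forall>b\<in>Basis. s < x \<bullet> b \<and> x \<bullet> b < 2 * s)"
  by (simp add: scale_box_def mem_box)

lemma scale_box_borel [measurable]: "scale_box s \<in> sets borel"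
  by (simp add: scale_box_def)

lemma emeasure_scale_box:
  assumes "0 \<le> s"
  shows "emeasure lborel (scale_box s :: 'a::euclidean_space set) = ennreal (s ^ DIM('a))"
  unfolding scale_box_def using assms by (subst emeasure_lborel_box) (auto simp: inner_diff_left)

lemma scale_box_disjoint:
  assumes "2 * s \<le> s'"
  shows "(scale_box s :: 'a::euclidean_space set) \<inter> scale_box s' = {}"
proof -
  obtain b :: 'a where "b \<in> Basis" using nonempty_Basis by blast
  with assms show ?thesis
    by (force simp: mem_scale_box)
qed

lemma indicator_scale_box:
  "(indicator (scale_box s) x :: complex) = (\<Prod>b\<in>Basis. indicator {s<..<2 * s} (x \<bullet> b))"
proof (cases "x \<in> scale_box s")
  case True
  then show ?thesis
    by (simp add: mem_scale_box)
next
  case False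
  then obtain b where "b \<in> Basis" "x \<bullet> b \<notin> {s<..<2 * s}"
    by (auto simp: mem_scale_box)
  then have "(\<Prod>b\<in>Basis. indicator {s<..<2 * s} (x \<bullet> b)) = (0 :: complex)"
    by (intro prod_zero) (auto simp: Bex_def intro!: exI[of _ b])
  then show ?thesis
    using False by simp
qed

definition box_fourier :: "real \<Rightarrow> 'a::euclidean_space \<Rightarrow> complex" where
  "box_fourier s \<xi> = (\<integral>x. indicator (scale_box s) x * exp (- \<i> * complex_of_real (\<xi> \<bullet> x)) \<partial>lborel)"

text \<open>The indicator of a box and the exponential of an inner product both factor over the
  coordinates.\<close>

lemma box_fourier_eq_prod:
  fixes \<xi> :: "'a::euclidean_space"
  shows "box_fourier s \<xi> = (\<Prod>b\<in>Basis. interval_fourier s (\<xi> \<bullet> b))"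
proof -
  have "indicator (scale_box s) x * exp (- \<i> * complex_of_real (\<xi> \<bullet> x)) =
      (\<Prod>b\<in>Basis. indicator {s<..<2 * s} (x \<bullet> b) * exp (- \<i> * complex_of_real ((\<xi> \<bullet> b) * (x \<bullet> b))))"
    for x :: 'a
  proof -
    have "exp (- \<i> * complex_of_real (\<xi> \<bullet> x)) =
        exp (\<Sum>b\<in>Basis. - \<i> * complex_of_real ((\<xi> \<bullet> b) * (x \<bullet> b)))"
      by (simp only: euclidean_inner[of \<xi> x] of_real_sum sum_distrib_left)
    also have "\<dots> = (\<Prod>b\<in>Basis. exp (- \<i> * complex_of_real ((\<xi> \<bullet> b) * (x \<bullet> b))))"
      by (simp add: exp_sum)
    finally show ?thesis
      by (simp add: indicator_scale_box prod.distrib)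
  qed
  then show ?thesis
    unfolding box_fourier_def interval_fourier_def
    by (simp only: integral_lborel_prod[OF integrable_interval_fourier])
qed

lemma norm_box_fourier_le:
  fixes \<xi> :: "'a::euclidean_space"
  assumes "0 \<le> s"
  shows "cmod (box_fourier s \<xi>) \<le> s ^ DIM('a)"
proof -
  have "cmod (box_fourier s \<xi>) \<le> (\<Prod>b\<in>(Basis :: 'a set). s)"
    unfolding box_fourier_eq_prod prod_norm[symmetric]
    using assms by (intro prod_mono) (auto intro: norm_interval_fourier_le)
  then show ?thesis by simp
qed

text \<open>Every coordinate of \<xi> exceeds l, so each of the one-dimensional factors
  decays.\<close>

lemma norm_box_fourier_le_decay:
  fixes \<xi> :: "'a::euclidean_space"
  assumes "0 \<le> s" "0 < l" "\<xi> \<in> scale_box l"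
  shows "cmod (box_fourier s \<xi>) \<le> (2 / l) ^ DIM('a)"
proof -
  have "cmod (box_fourier s \<xi>) \<le> (\<Prod>b\<in>(Basis :: 'a set). 2 / l)"
    unfolding box_fourier_eq_prod prod_norm[symmetric]
  proof (intro prod_mono conjI)
    fix b :: 'a assume "b \<in> Basis"
    then have "l < \<xi> \<bullet> b" using assms by (auto simp: mem_scale_box)
    then show "cmod (interval_fourier s (\<xi> \<bullet> b)) \<le> 2 / l"
      using norm_interval_fourier_le_decay[OF assms(1), of "\<xi> \<bullet> b"] assms(2)
        divide_left_mono[of l "\<xi> \<bullet> b" 2] by simp
  qed auto
  then show ?thesis by simp
qed

text \<open>The scales 1 / l and l are dual: every coordinate of \<xi> is below 2 l = 2 / (1 / l),
  which is the range in which the transform of the interval is known not to cancel.\<close>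

lemma norm_box_fourier_ge:
  fixes \<xi> :: "'a::euclidean_space"
  assumes "0 < l" "\<xi> \<in> scale_box l"
  shows "(1 / (2 * l)) ^ DIM('a) \<le> cmod (box_fourier (1 / l) \<xi>)"
proof -
  have "(\<Prod>b\<in>(Basis :: 'a set). 1 / l / 2) \<le> cmod (box_fourier (1 / l) \<xi>)"
    unfolding box_fourier_eq_prod prod_norm[symmetric]
  proof (intro prod_mono conjI)
    fix b :: 'a assume "b \<in> Basis"
    then have "l < \<xi> \<bullet> b" "\<xi> \<bullet> b < 2 * l" using assms by (auto simp: mem_scale_box)
    then show "1 / l / 2 \<le> cmod (interval_fourier (1 / l) (\<xi> \<bullet> b))"
      using assms(1) by (intro norm_interval_fourier_ge) auto
  qed (use assms in auto)
  then show ?thesis by (simp add: mult.commute)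
qed

subsection \<open>Lorentz norms\<close>

lemma epowr_ennreal: "0 \<le> x \<Longrightarrow> epowr (ennreal x) s = ennreal (x powr s)"
  by (simp add: epowr_def)

lemma epowr_mono:
  assumes "x \<le> y" "0 \<le> s"
  shows "epowr x s \<le> epowr y s"
  using assms by (cases x; cases y) (auto simp: epowr_ennreal epowr_def top_unique intro!: ennreal_leI powr_mono2)

text \<open>Removes the outer root from the norms, so that the estimates can be made on the
  integrals.\<close>

lemma epowr_powr_inverse:
  assumes "0 < s"
  shows "epowr (epowr x (1 / s)) s = x"
  using assms by (cases x) (auto simp: epowr_def powr_powr)

text \<open>A level \<tau> below \<gamma> has \<open>A\<close> inside its superlevel set, whose
  measure then exceeds t, so \<tau> does not compete in the infimum.\<close>

lemma rearrangement_ge: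
  assumes f: "f \<in> borel_measurable lebesgue" and A: "A \<in> sets lebesgue" "ennreal t < emeasure lebesgue A"
    and ge: "\<And>x. x \<in> A \<Longrightarrow> \<gamma> \<le> cmod (f x)"
  shows "ennreal \<gamma> \<le> rearrangement (abs_L0 f) t"
proof -
  have "\<gamma> \<le> \<tau>" if le: "emeasure lebesgue {x. \<tau> < cmod (f x)} \<le> ennreal t" for \<tau>
  proof (rule ccontr)
    assume "\<not> \<gamma> \<le> \<tau>"
    then have "A \<subseteq> {x. \<tau> < cmod (f x)}"
      using ge by force
    moreover have "{x \<in> space lebesgue. \<tau> < cmod (f x)} \<in> sets lebesgue"
      using f by measurable
    ultimately have "emeasure lebesgue A \<le> emeasure lebesgue {x. \<tau> < cmod (f x)}"
      by (intro emeasure_mono) auto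
    with le A(2) show False
      by simp
  qed
  moreover have "ae_eq f f"
    using f by (simp add: ae_eq_def)
  ultimately show ?thesis
    by (subst rearrangement.abs_eq) (auto intro!: Inf_greatest ennreal_leI)
qed

text \<open>For s in [t_n / 2, t_n) the rearrangement is at least \<gamma>_n, and these intervals
  are disjoint. Each has length t_n / 2, and replacing s^(1/q) and 1 / s by their least values costs
  the remaining part of the factor 2^(-1 - p/q).\<close>

lemma Lorentz_integral_ge:
  fixes f :: "real ^ 'd::finite \<Rightarrow> complex" and t \<gamma> :: "nat \<Rightarrow> real"
  assumes f: "f \<in> borel_measurable lebesgue" and q: "0 < q" and p: "0 < p"
    and t: "\<And>n. 0 < t n" "\<And>n. 2 * t n \<le> t (Suc n)"
    and A: "\<And>n. A n \<in> sets lebesgue" "\<And>n. ennreal (t n) \<le> emeasure lebesgue (A n)"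
    and \<gamma>: "\<And>n. 0 \<le> \<gamma> n" "\<And>n x. x \<in> A n \<Longrightarrow> \<gamma> n \<le> cmod (f x)"
  shows "ennreal (2 powr (- 1 - p / q) * (\<Sum>n<N. (t n powr (1 / q) * \<gamma> n) powr p)) \<le>
    (\<integral>\<^sup>+ s \<in> {0<..}. epowr (ennreal (s powr (1 / q)) * rearrangement (abs_L0 f) s) p * ennreal (1 / s) \<partial>lborel)"
proof -
  \<comment> \<open>The lower bound for the integrand on the n-th interval, from s \<ge> t_n / 2 in
    the power and 1 / s \<ge> 1 / t_n in the measure.\<close>
  define c where "c n = 2 powr (- p / q) * (t n powr (1 / q) * \<gamma> n) powr p / t n" for n
  have c0: "0 \<le> c n" for n
    using t(1)[of n] by (simp add: c_def)
  have "t n \<le> t (Suc n)" for n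
    using t(1)[of n] t(2)[of n] by linarith
  then have mono: "t n \<le> t m" if "n \<le> m" for n m
    using that by (rule lift_Suc_mono_le)
  have gap: "2 * t n \<le> t m" if "n < m" for n m
    using t(2)[of n] mono[of "Suc n" m] that by simp
  let ?I = "\<lambda>n. {t n / 2..<t n}"
  let ?h = "\<lambda>s. epowr (ennreal (s powr (1 / q)) * rearrangement (abs_L0 f) s) p * ennreal (1 / s)"
  have "ennreal (2 powr (- 1 - p / q) * (\<Sum>n<N. (t n powr (1 / q) * \<gamma> n) powr p)) =
      (\<Sum>n<N. ennreal (c n * (t n / 2)))"
  proof (subst sum_ennreal)
    have "2 powr (- 1 - p / q) * (\<Sum>n<N. (t n powr (1 / q) * \<gamma> n) powr p) = (\<Sum>n<N. c n * (t n / 2))"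
      unfolding sum_distrib_left
    proof (intro sum.cong refl)
      fix n
      have "2 powr (- 1 - p / q) = 2 powr (- p / q) / (2::real)"
        by (subst diff_conv_add_uminus, subst powr_add) (simp add: powr_minus)
      then show "2 powr (- 1 - p / q) * (t n powr (1 / q) * \<gamma> n) powr p = c n * (t n / 2)"
        using t(1)[of n] by (simp add: c_def)
    qed
    then show "ennreal (2 powr (- 1 - p / q) * (\<Sum>n<N. (t n powr (1 / q) * \<gamma> n) powr p)) =
        ennreal (\<Sum>n<N. c n * (t n / 2))"
      by simp
  qed (use c0 t(1) in \<open>auto intro!: mult_nonneg_nonneg simp: less_imp_le\<close>)
  also have "\<dots> = (\<Sum>n<N. ennreal (c n) * emeasure lborel (?I n))"
  proof (intro sum.cong refl)
    fix n
    have "ennreal (c n * (t n / 2)) = ennreal (c n) * ennreal (t n / 2)"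
      using c0[of n] t(1)[of n] by (intro ennreal_mult) auto
    then show "ennreal (c n * (t n / 2)) = ennreal (c n) * emeasure lborel (?I n)"
      using t(1)[of n] by simp
  qed
  also have "\<dots> = (\<integral>\<^sup>+ s. (\<Sum>n<N. ennreal (c n) * indicator (?I n) s) \<partial>lborel)"
    by (subst nn_integral_sum, measurable)
      (intro sum.cong refl nn_integral_cmult_indicator[symmetric], simp)
  also have "\<dots> \<le> (\<integral>\<^sup>+ s \<in> {0<..}. ?h s \<partial>lborel)"
  proof (rule nn_integral_mono)
    fix s :: real
    show "(\<Sum>n<N. ennreal (c n) * indicator (?I n) s) \<le> ?h s * indicator {0<..} s"
    proof (cases "\<exists>n<N. s \<in> ?I n")
      case True
      then obtain n where n: "n < N" "t n / 2 \<le> s" "s < t n" by auto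
      have s: "0 < s" using n t(1)[of n] by linarith
      \<comment> \<open>The \<open>t n\<close> at least double, so at most one interval contains
        \<open>s\<close>.\<close>
      have "s \<notin> ?I m" if "m \<noteq> n" for m
        using gap[of n m] gap[of m n] that n by (cases m n rule: linorder_cases) auto
      then have "(\<Sum>m<N. ennreal (c m) * indicator (?I m) s) = (\<Sum>m\<in>{n}. ennreal (c m) * indicator (?I m) s)"
        using n by (intro sum.mono_neutral_right) auto
      also have "\<dots> = ennreal (c n)"
        using n by simp
      also have "\<dots> \<le> ennreal ((s powr (1 / q) * \<gamma> n) powr p * (1 / s))"
      proof (rule ennreal_leI)
        have "2 powr (- p / q) * (t n powr (1 / q) * \<gamma> n) powr p = ((t n / 2) powr (1 / q) * \<gamma> n) powr p"
          using t(1)[of n] \<gamma>(1)[of n] by (simp add: powr_mult powr_divide powr_powr powr_minus_divide)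
        also have "\<dots> \<le> (s powr (1 / q) * \<gamma> n) powr p"
          using n t(1)[of n] \<gamma>(1)[of n] p q by (intro powr_mono2 mult_right_mono) auto
        finally have "2 powr (- p / q) * (t n powr (1 / q) * \<gamma> n) powr p * (1 / t n) \<le>
            (s powr (1 / q) * \<gamma> n) powr p * (1 / s)"
          using n s by (intro mult_mono) (auto simp: frac_le)
        then show "c n \<le> (s powr (1 / q) * \<gamma> n) powr p * (1 / s)"
          by (simp add: c_def)
      qed
      also have "\<dots> = epowr (ennreal (s powr (1 / q)) * ennreal (\<gamma> n)) p * ennreal (1 / s)"
        using \<gamma>(1)[of n] s by (simp add: ennreal_mult[symmetric] epowr_ennreal)
      also have "\<dots> \<le> ?h s"
      proof (intro mult_right_mono epowr_mono mult_left_mono rearrangement_ge f A \<gamma>)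
        \<comment> \<open>Excluding the right endpoint of the interval provides the strict
          inequality that \<open>rearrangement_ge\<close> demands.\<close>
        show "ennreal s < emeasure lebesgue (A n)"
          using n(3) s by (intro less_le_trans[OF _ A(2)]) (simp add: ennreal_less_iff)
      qed (use p A(1) in auto)
      also have "\<dots> = ?h s * indicator {0<..} s"
        using s by simp
      finally show ?thesis .
    next
      case False
      then have "(\<Sum>n<N. ennreal (c n) * indicator (?I n) s) = 0"
        by (intro sum.neutral) auto
      then show ?thesis by simp
    qed
  qed
  finally show ?thesis .
qed

subsection \<open>Step functions on the boxes\<close>

text \<open>The coefficients are arbitrary. For L \<ge> 2 the boxes are disjoint, so at each point
  at most one term of the series is nonzero.\<close>

definition step :: "real \<Rightarrow> (nat \<Rightarrow> complex) \<Rightarrow> 'a::euclidean_space \<Rightarrow> complex" where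
  "step L a x = (\<Sum>n. a n * indicator (scale_box (1 / L ^ n)) x)"

lemma step_boxes_disjoint:
  fixes x :: "'a::euclidean_space"
  assumes L: "2 \<le> L" and x: "x \<in> scale_box (1 / L ^ n)" "x \<in> scale_box (1 / L ^ m)"
  shows "m = n"
proof -
  have *: "False" if "n < m" "x \<in> scale_box (1 / L ^ n)" "x \<in> scale_box (1 / L ^ m)" for n m
  proof -
    have "2 * L ^ n \<le> L * L ^ n"
      using L by (intro mult_right_mono) auto
    also have "L * L ^ n = L ^ Suc n"
      by simp
    also have "\<dots> \<le> L ^ m"
      using L that by (intro power_increasing) auto
    finally have "2 * (1 / L ^ m) \<le> 1 / L ^ n"
      using L by (simp add: field_simps)
    from scale_box_disjoint[OF this, where 'a = 'a] that show False
      by auto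
  qed
  show ?thesis
    using *[of n m] *[of m n] x by (cases m n rule: linorder_cases) auto
qed

text \<open>The general codomain covers complex coefficients, their real moduli and their powers in
  \<open>ennreal\<close>.\<close>

lemma sums_step:
  fixes c :: "nat \<Rightarrow> 'b::{semiring_1, comm_monoid_add, t2_space}"
  assumes "2 \<le> L" "x \<in> scale_box (1 / L ^ n)"
  shows "(\<lambda>m. c m * indicator (scale_box (1 / L ^ m)) x) sums c n"
proof -
  have "c m * indicator (scale_box (1 / L ^ m)) x = (if m = n then c m else 0)" for m
  proof (cases "m = n")
    case False
    then have "x \<notin> scale_box (1 / L ^ m)"
      using step_boxes_disjoint[OF assms] by metis
    with False show ?thesis
      by simp
  qed (use assms(2) in simp)
  then show ?thesis
    using sums_single[of n c] by (simp only:)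
qed

lemma step_in: "2 \<le> L \<Longrightarrow> x \<in> scale_box (1 / L ^ n) \<Longrightarrow> step L a x = a n"
  using sums_step[of L x n a] by (simp add: step_def sums_iff)

lemma step_out: "(\<And>n. x \<notin> scale_box (1 / L ^ n)) \<Longrightarrow> step L a x = 0"
  by (simp add: step_def)

lemma step_borel [measurable]: "step L a \<in> borel_measurable borel"
  unfolding step_def by measurable

lemma step_lebesgue [measurable]: "step L a \<in> borel_measurable lebesgue"
  by (intro measurable_completion) simp

lemma step_linear:
  assumes L: "2 \<le> L"
  shows "step L (\<lambda>n. a n + b n) x = step L a x + step L b x"
    and "step L (\<lambda>n. c * a n) x = c * step L a x"
proof -
  have "step L (\<lambda>n. a n + b n) x = step L a x + step L b x \<and> step L (\<lambda>n. c * a n) x = c * step L a x"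
  proof (cases "\<exists>n. x \<in> scale_box (1 / L ^ n)")
    case True
    then obtain n where "x \<in> scale_box (1 / L ^ n)" by blast
    note step_in[OF L this]
    then show ?thesis by simp
  qed (simp add: step_out)
  then show "step L (\<lambda>n. a n + b n) x = step L a x + step L b x"
    and "step L (\<lambda>n. c * a n) x = c * step L a x" by auto
qed

lemma nn_integral_step_powr:
  assumes L: "2 \<le> L"
  shows "(\<integral>\<^sup>+ x. ennreal (cmod (step L a (x :: 'a::euclidean_space)) powr p) \<partial>lebesgue) =
    (\<Sum>n. ennreal (cmod (a n) powr p * (1 / L ^ n) ^ DIM('a)))"
proof -
  have "ennreal (cmod (step L a x) powr p) =
      (\<Sum>n. ennreal (cmod (a n) powr p) * indicator (scale_box (1 / L ^ n)) x)" for x :: 'a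
  proof (cases "\<exists>n. x \<in> scale_box (1 / L ^ n)")
    case True
    then obtain n where n: "x \<in> scale_box (1 / L ^ n)" by blast
    show ?thesis
      using sums_step[OF L n, of "\<lambda>n. ennreal (cmod (a n) powr p)"] step_in[OF L n]
      by (simp add: sums_iff)
  qed (simp add: step_out)
  then have "(\<integral>\<^sup>+ x. ennreal (cmod (step L a (x :: 'a)) powr p) \<partial>lebesgue) =
      (\<integral>\<^sup>+ x. (\<Sum>n. ennreal (cmod (a n) powr p) * indicator (scale_box (1 / L ^ n)) (x :: 'a)) \<partial>lborel)"
    by (simp add: nn_integral_completion)
  also have "\<dots> = (\<Sum>n. \<integral>\<^sup>+ x. ennreal (cmod (a n) powr p) * indicator (scale_box (1 / L ^ n)) (x :: 'a) \<partial>lborel)"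
    by (rule nn_integral_suminf) measurable
  also have "\<dots> = (\<Sum>n. ennreal (cmod (a n) powr p) * emeasure lborel (scale_box (1 / L ^ n) :: 'a set))"
    by (intro suminf_cong nn_integral_cmult_indicator) simp
  also have "\<dots> = (\<Sum>n. ennreal (cmod (a n) powr p * (1 / L ^ n) ^ DIM('a)))"
  proof (intro suminf_cong)
    fix n
    show "ennreal (cmod (a n) powr p) * emeasure lborel (scale_box (1 / L ^ n) :: 'a set) =
        ennreal (cmod (a n) powr p * (1 / L ^ n) ^ DIM('a))"
      using L by (simp only: emeasure_scale_box ennreal_mult zero_le_power zero_le_divide_1_iff powr_ge_zero)
  qed
  finally show ?thesis .
qed

text \<open>The hypothesis \<open>sum\<close> says that the \<L>-one norms of the terms are
  summable, which justifies integrating termwise.\<close>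

lemma fourier_integral_step:
  fixes \<xi> :: "real ^ 'd::finite"
  assumes L: "2 \<le> L" and sum: "summable (\<lambda>n. cmod (a n) * (1 / L ^ n) ^ CARD('d))"
  shows "fourier_integral (step L a) \<xi> = (\<Sum>n. a n * box_fourier (1 / L ^ n) \<xi>)"
proof -
  let ?e = "\<lambda>x. exp (- \<i> * complex_of_real (\<xi> \<bullet> x))"
  let ?B = "\<lambda>n. scale_box (1 / L ^ n) :: (real ^ 'd) set"
  let ?f = "\<lambda>n x. a n * (indicator (?B n) x * ?e x)"
  have meas [measurable]: "?e \<in> borel_measurable borel"
    by (intro borel_measurable_continuous_onI continuous_intros)
  have iB: "integrable lborel (\<lambda>x. indicator (?B n) x :: real)" for n
    using L emeasure_scale_box[of "1 / L ^ n", where 'a = "real ^ 'd"]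
    by (intro integrable_real_indicator) auto
  have int: "integrable lborel (?f n)" for n
    by (rule Bochner_Integration.integrable_bound[OF integrable_mult_right[OF iB, of "cmod (a n)"]])
      (auto simp: norm_mult split: split_indicator)
  have norm: "(\<integral>x. norm (?f n x) \<partial>lborel) = cmod (a n) * (1 / L ^ n) ^ CARD('d)" for n
  proof -
    have "(\<integral>x. norm (?f n x) \<partial>lborel) = (\<integral>x. cmod (a n) * indicator (?B n) x \<partial>lborel)"
      by (intro Bochner_Integration.integral_cong) (auto simp: norm_mult split: split_indicator)
    also have "\<dots> = cmod (a n) * measure lborel (?B n)"
      by simp
    also have "measure lborel (?B n) = (1 / L ^ n) ^ CARD('d)"
      using L by (simp add: measure_def emeasure_scale_box)
    finally show ?thesis .
  qed
  have "fourier_integral (step L a) \<xi> = (\<integral>x. step L a x * ?e x \<partial>lborel)"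
    unfolding fourier_integral_def by (rule integral_completion) measurable
  also have "\<dots> = (\<integral>x. (\<Sum>n. ?f n x) \<partial>lborel)"
  proof (intro Bochner_Integration.integral_cong refl)
    fix x :: "real ^ 'd"
    show "step L a x * ?e x = (\<Sum>n. ?f n x)"
    proof (cases "\<exists>n. x \<in> ?B n")
      case True
      then obtain n where n: "x \<in> ?B n" by blast
      show ?thesis
        using sums_mult2[OF sums_step[OF L n, of a], of "?e x"] step_in[OF L n]
        by (simp add: sums_iff mult.assoc)
    qed (simp add: step_out)
  qed
  also have "\<dots> = (\<Sum>n. \<integral>x. ?f n x \<partial>lborel)"
  proof (rule integral_suminf)
    show "AE x in lborel. summable (\<lambda>n. norm (?f n x))"
    proof (rule AE_I2)
      fix x :: "real ^ 'd"
      show "summable (\<lambda>n. norm (?f n x))"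
      proof (cases "\<exists>n. x \<in> ?B n")
        case True
        then obtain n where n: "x \<in> ?B n" by blast
        have "norm (?f m x) = cmod (a m) * indicator (?B m) x" for m
          by (simp add: norm_mult split: split_indicator)
        then show ?thesis
          using sums_step[OF L n, of "\<lambda>m. cmod (a m)"] by (simp add: sums_iff)
      next
        case False
        then have "?f n x = 0" for n
          by simp
        then show ?thesis
          by (simp only: norm_zero summable_zero)
      qed
    qed
    show "summable (\<lambda>n. \<integral>x. norm (?f n x) \<partial>lborel)"
      unfolding norm by (rule sum)
  qed (rule int)
  also have "\<dots> = (\<Sum>n. a n * box_fourier (1 / L ^ n) \<xi>)"
    unfolding box_fourier_def by simp
  finally show ?thesis .
qed

text \<open>With b_m = |a_m| \<sigma>^m, and after division by r^(2 n), the diagonal term on the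
  n-th frequency box is at least b_n / 2^d, while the m-th term is at most 2^d r^(2 |m - n|)
  b_m.\<close>

lemma norm_fourier_step_ge:
  fixes \<xi> :: "real ^ 'd::finite" and a :: "nat \<Rightarrow> complex"
  assumes L: "2 \<le> L" and pos: "0 < \<sigma>" "0 < r" and le: "\<sigma> \<le> r\<^sup>2"
    and prod: "\<sigma> * r\<^sup>2 = (1 / L) ^ CARD('d)"
    and sum: "summable (\<lambda>n. cmod (a n) * (1 / L ^ n) ^ CARD('d))"
    and sum': "summable (\<lambda>m. (off_diag r n m)\<^sup>2 * (cmod (a m) * \<sigma> ^ m))"
    and \<xi>: "\<xi> \<in> scale_box (L ^ n)"
  shows "cmod (a n) * \<sigma> ^ n / 2 ^ CARD('d) - 2 ^ CARD('d) * (\<Sum>m. (off_diag r n m)\<^sup>2 * (cmod (a m) * \<sigma> ^ m))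
    \<le> cmod (fourier_integral (step L a) \<xi>) / (r\<^sup>2) ^ n"
proof -
  define d where "d = CARD('d)"
  define \<rho> where "\<rho> = r\<^sup>2"
  have \<rho>: "0 < \<rho>" "\<sigma> \<le> \<rho>"
    using pos le by (auto simp: \<rho>_def)
  have prod': "(1 / L ^ m) ^ d = \<sigma> ^ m * \<rho> ^ m" for m
  proof -
    have "(1 / L ^ m) ^ d = ((1 / L) ^ d) ^ m"
      by (simp add: power_divide power_mult[symmetric] mult.commute)
    also have "(1 / L) ^ d = \<sigma> * \<rho>"
      using prod by (simp only: d_def \<rho>_def)
    finally show ?thesis
      by (simp add: power_mult_distrib)
  qed
  define u where "u m = a m * box_fourier (1 / L ^ m) \<xi>" for m
  define v where "v m = (if m = n then 0 else u m)" for m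
  have norm_u: "cmod (u m) \<le> cmod (a m) * (1 / L ^ m) ^ d" for m
    unfolding u_def norm_mult d_def
    using L norm_box_fourier_le[of "1 / L ^ m" \<xi>] by (intro mult_left_mono) auto
  have "summable u"
    by (rule summable_comparison_test'[OF sum, of 0]) (use norm_u in \<open>simp add: d_def\<close>)
  then have "u sums (\<Sum>m. u m)"
    by (rule summable_sums)
  from sums_diff[OF this sums_single[of n u]]
  have "v sums ((\<Sum>m. u m) - u n)"
    by (rule back_subst[of "\<lambda>f. f sums _"]) (auto simp: v_def)
  then have eq: "u n = fourier_integral (step L a) \<xi> - (\<Sum>m. v m)"
    using fourier_integral_step[OF L sum] by (simp add: sums_iff u_def)
  have norm_v: "cmod (v m) \<le> 2 ^ d * \<rho> ^ n * ((off_diag r n m)\<^sup>2 * (cmod (a m) * \<sigma> ^ m))" for m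
  proof (cases m n rule: linorder_cases)
    \<comment> \<open>The box in space is large compared with the inverse frequency, so oscillation
      gives (2 / L^n)^d. Splitting \<sigma>^n at m and using \<sigma> \<le> \<rho> on the excess n -
      m produces the kernel.\<close>
    case less
    have "cmod (v m) = cmod (a m) * cmod (box_fourier (1 / L ^ m) \<xi>)"
      using less by (simp add: v_def u_def norm_mult)
    also have "\<dots> \<le> cmod (a m) * (2 / L ^ n) ^ d"
      using L \<xi> norm_box_fourier_le_decay[of "1 / L ^ m" "L ^ n" \<xi>] by (intro mult_left_mono) (auto simp: d_def)
    also have "(2 / L ^ n) ^ d = 2 ^ d * (\<sigma> ^ n * \<rho> ^ n)"
      unfolding prod'[symmetric] by (simp add: power_divide)
    also have "\<sigma> ^ n = \<sigma> ^ m * \<sigma> ^ (n - m)"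
      using less by (simp add: power_add[symmetric])
    also have "cmod (a m) * (2 ^ d * (\<sigma> ^ m * \<sigma> ^ (n - m) * \<rho> ^ n)) \<le>
        cmod (a m) * (2 ^ d * (\<sigma> ^ m * \<rho> ^ (n - m) * \<rho> ^ n))"
      using pos \<rho> by (intro mult_left_mono mult_right_mono power_mono) auto
    also have "\<rho> ^ (n - m) = (off_diag r n m)\<^sup>2"
      using less by (simp add: off_diag_def \<rho>_def power_mult[symmetric] mult.commute)
    finally show ?thesis
      by (simp add: mult_ac)
  next
    case equal
    then show ?thesis
      using pos \<rho> by (simp add: v_def)
  next
    \<comment> \<open>Here the volume bound suffices, since \<rho>^m = \<rho>^n \<rho>^(m - n); the
      factor 2^d only matches the constant of the other case.\<close>
    case greater
    have "cmod (v m) \<le> cmod (a m) * (1 / L ^ m) ^ d"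
      using greater norm_u by (simp add: v_def)
    also have "\<dots> = cmod (a m) * (\<sigma> ^ m * (\<rho> ^ n * \<rho> ^ (m - n)))"
      using greater by (simp add: prod' power_add[symmetric])
    also have "\<dots> \<le> 2 ^ d * (cmod (a m) * (\<sigma> ^ m * (\<rho> ^ n * \<rho> ^ (m - n))))"
      using pos \<rho> mult_right_mono[of 1 "2 ^ d" "cmod (a m) * (\<sigma> ^ m * (\<rho> ^ n * \<rho> ^ (m - n)))"] by simp
    also have "\<rho> ^ (m - n) = (off_diag r n m)\<^sup>2"
      using greater by (simp add: off_diag_def \<rho>_def power_mult[symmetric] mult.commute)
    finally show ?thesis
      by (simp add: mult_ac)
  qed
  have "cmod (\<Sum>m. v m) \<le> (\<Sum>m. 2 ^ d * \<rho> ^ n * ((off_diag r n m)\<^sup>2 * (cmod (a m) * \<sigma> ^ m)))"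
    by (intro norm_suminf_le norm_v summable_mult sum')
  also have "\<dots> = 2 ^ d * \<rho> ^ n * (\<Sum>m. (off_diag r n m)\<^sup>2 * (cmod (a m) * \<sigma> ^ m))"
    by (intro suminf_mult sum')
  finally have v: "cmod (\<Sum>m. v m) \<le> 2 ^ d * \<rho> ^ n * (\<Sum>m. (off_diag r n m)\<^sup>2 * (cmod (a m) * \<sigma> ^ m))" .
  have "cmod (a n) * \<sigma> ^ n / 2 ^ d * \<rho> ^ n = cmod (a n) * (1 / (2 * L ^ n)) ^ d"
  proof -
    have "cmod (a n) * \<sigma> ^ n / 2 ^ d * \<rho> ^ n = cmod (a n) * ((1 / L ^ n) ^ d / 2 ^ d)"
      unfolding prod' by simp
    also have "(1 / L ^ n) ^ d / 2 ^ d = (1 / (2 * L ^ n)) ^ d"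
      by (simp add: power_divide power_mult_distrib)
    finally show ?thesis .
  qed
  also have "\<dots> \<le> cmod (u n)"
    unfolding u_def norm_mult d_def
    using L \<xi> norm_box_fourier_ge[of "L ^ n" \<xi>] by (intro mult_left_mono) auto
  also have "\<dots> \<le> cmod (fourier_integral (step L a) \<xi>) + cmod (\<Sum>m. v m)"
    unfolding eq by (rule norm_triangle_ineq4)
  finally have "(cmod (a n) * \<sigma> ^ n / 2 ^ d - 2 ^ d * (\<Sum>m. (off_diag r n m)\<^sup>2 * (cmod (a m) * \<sigma> ^ m))) * \<rho> ^ n
      \<le> cmod (fourier_integral (step L a) \<xi>)"
    using v by (simp add: algebra_simps)
  then show ?thesis
    using \<rho> by (simp add: d_def \<rho>_def pos_le_divide_eq)
qed

subsection \<open>The space of step functions\<close>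

lemma ae_eq_self: "f \<in> borel_measurable lebesgue \<Longrightarrow> ae_eq f f"
  by (simp add: ae_eq_def)

text \<open>The quotient is partial: \<open>abs_L0\<close> is meaningful only on measurable
  functions, so a measurable representative has to be supplied.\<close>

lemma L0_cases:
  obtains f where "f \<in> borel_measurable lebesgue" "F = abs_L0 f"
  using Quotient_rep_reflp[OF Quotient_L0, of F] Quotient_abs_rep[OF Quotient_L0, of F]
  by (auto simp: ae_eq_def)

lemma abs_L0_eq_iff:
  assumes "f \<in> borel_measurable lebesgue" "g \<in> borel_measurable lebesgue"
  shows "abs_L0 f = abs_L0 g \<longleftrightarrow> (AE x in lebesgue. f x = g x)"
  using Quotient_rel[OF Quotient_L0, of f g] assms
  by (auto simp: ae_eq_def)

lemma Lp_norm_abs_L0: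
  "f \<in> borel_measurable lebesgue \<Longrightarrow>
    Lp_norm p (abs_L0 f) = epowr (\<integral>\<^sup>+ x. ennreal (cmod (f x) powr p) \<partial>lebesgue) (1 / p)"
  by (simp add: Lp_norm.abs_eq ae_eq_self)

lemma abs_L0_in_Lp_iff:
  "f \<in> borel_measurable lebesgue \<Longrightarrow>
    abs_L0 f \<in> Lp p \<longleftrightarrow> (\<integral>\<^sup>+ x. ennreal (cmod (f x) powr p) \<partial>lebesgue) < \<infinity>"
  by (auto simp: Lp_def Lp_norm_abs_L0 epowr_def top.not_eq_extremum)

text \<open>Only finiteness of the integrals matters, so \<open>add_powr_le\<close> takes the place
  of Minkowski's inequality.\<close>

lemma subspace_Lp:
  assumes p: "0 \<le> p"
  shows "L0.subspace (Lp p :: 'd::finite L0 set)"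
  unfolding L0.subspace_def
proof (intro conjI ballI allI)
  show "(0 :: 'd L0) \<in> Lp p"
    by (simp add: zero_L0_def abs_L0_in_Lp_iff)
next
  fix F G :: "'d L0" assume FG: "F \<in> Lp p" "G \<in> Lp p"
  obtain f where f [measurable]: "f \<in> borel_measurable lebesgue" and F: "F = abs_L0 f" by (rule L0_cases)
  obtain g where g [measurable]: "g \<in> borel_measurable lebesgue" and G: "G = abs_L0 g" by (rule L0_cases)
  have "(\<integral>\<^sup>+ x. ennreal (cmod (f x + g x) powr p) \<partial>lebesgue) \<le>
      (\<integral>\<^sup>+ x. ennreal (2 powr p) * (ennreal (cmod (f x) powr p) + ennreal (cmod (g x) powr p)) \<partial>lebesgue)"
  proof (rule nn_integral_mono)
    fix x
    have "cmod (f x + g x) powr p \<le> (cmod (f x) + cmod (g x)) powr p"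
      using p by (intro powr_mono2 norm_triangle_ineq) auto
    also have "\<dots> \<le> 2 powr p * (cmod (f x) powr p + cmod (g x) powr p)"
      using p by (intro add_powr_le) auto
    finally show "ennreal (cmod (f x + g x) powr p) \<le>
        ennreal (2 powr p) * (ennreal (cmod (f x) powr p) + ennreal (cmod (g x) powr p))"
      by (simp add: ennreal_plus[symmetric] ennreal_mult[symmetric] del: ennreal_plus)
  qed
  also have "\<dots> = ennreal (2 powr p) * ((\<integral>\<^sup>+ x. ennreal (cmod (f x) powr p) \<partial>lebesgue) +
      (\<integral>\<^sup>+ x. ennreal (cmod (g x) powr p) \<partial>lebesgue))"
    by (simp add: nn_integral_cmult nn_integral_add)
  also have "\<dots> < \<infinity>"
    using FG by (simp add: F G abs_L0_in_Lp_iff ennreal_mult_less_top)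
  finally show "F + G \<in> Lp p"
    by (simp add: F G plus_L0.abs_eq ae_eq_self abs_L0_in_Lp_iff)
next
  fix c and F :: "'d L0" assume "F \<in> Lp p"
  obtain f where f [measurable]: "f \<in> borel_measurable lebesgue" and F: "F = abs_L0 f" by (rule L0_cases)
  have "(\<integral>\<^sup>+ x. ennreal (cmod (c * f x) powr p) \<partial>lebesgue) =
      ennreal (cmod c powr p) * (\<integral>\<^sup>+ x. ennreal (cmod (f x) powr p) \<partial>lebesgue)"
    by (simp add: norm_mult powr_mult ennreal_mult nn_integral_cmult)
  then show "scaleC_L0 c F \<in> Lp p"
    using \<open>F \<in> Lp p\<close> by (simp add: F scaleC_L0.abs_eq ae_eq_self abs_L0_in_Lp_iff ennreal_mult_less_top)
qed

text \<open>The p-th powers of the differences tend to 0 in mean, and a sequence doing so has a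
  subsequence tending to 0 almost everywhere.\<close>

lemma Lp_tendsto_imp_AE_subseq:
  fixes f :: "nat \<Rightarrow> real ^ 'd::finite \<Rightarrow> complex"
  assumes p: "0 < p" and f [measurable]: "\<And>k. f k \<in> borel_measurable lebesgue"
    and g [measurable]: "g \<in> borel_measurable lebesgue"
    and Lp: "\<And>k. abs_L0 (f k) \<in> Lp p" "abs_L0 g \<in> Lp p"
    and lim: "(\<lambda>k. Lp_norm p (abs_L0 (f k) - abs_L0 g)) \<longlonglongrightarrow> 0"
  shows "\<exists>s. strict_mono s \<and> (AE x in lebesgue. (\<lambda>k. f (s k) x) \<longlonglongrightarrow> g x)"
proof -
  let ?h = "\<lambda>k x. cmod (f k x - g x) powr p"
  have diff: "abs_L0 (f k) - abs_L0 g = abs_L0 (\<lambda>x. f k x - g x)" for k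
    by (simp add: minus_L0.abs_eq ae_eq_self)
  have "abs_L0 (f k) - abs_L0 g \<in> Lp p" for k
    using subspace_Lp[of p] Lp p by (intro L0.subspace_diff) auto
  then have fin: "(\<integral>\<^sup>+ x. ennreal (?h k x) \<partial>lebesgue) < \<infinity>" for k
    by (simp add: diff abs_L0_in_Lp_iff)
  have int: "integrable lebesgue (?h k)" for k
    using fin[of k] by (intro integrableI_bounded) auto
  have eq: "(\<integral>x. norm (?h k x) \<partial>lebesgue) = enn2real (Lp_norm p (abs_L0 (f k) - abs_L0 g)) powr p" for k
  proof -
    have "(\<integral>x. norm (?h k x) \<partial>lebesgue) = enn2real (\<integral>\<^sup>+ x. ennreal (?h k x) \<partial>lebesgue)"
      using int[of k] by (subst integral_eq_nn_integral) auto
    then show ?thesis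
      using p fin[of k] by (simp add: diff Lp_norm_abs_L0 epowr_def powr_powr)
  qed
  have "(\<lambda>k. enn2real (Lp_norm p (abs_L0 (f k) - abs_L0 g)) powr p) \<longlonglongrightarrow> 0"
    using p lim tendsto_enn2real[where l = 0]
    by (intro tendsto_zero_powrI[where b = p]) auto
  then obtain s where s: "strict_mono s" "AE x in lebesgue. (\<lambda>k. ?h (s k) x) \<longlonglongrightarrow> 0"
    using tendsto_L1_AE_subseq[of lebesgue ?h] int unfolding eq by blast
  have "AE x in lebesgue. (\<lambda>k. f (s k) x) \<longlonglongrightarrow> g x"
    using s(2)
  proof eventually_elim
    case (elim x)
    have "(\<lambda>k. ?h (s k) x powr (1 / p)) \<longlonglongrightarrow> 0"
      using p by (intro tendsto_zero_powrI[OF elim tendsto_const]) auto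
    then have "(\<lambda>k. cmod (f (s k) x - g x)) \<longlonglongrightarrow> 0"
      using p by (simp add: powr_powr)
    then show ?case
      by (simp add: tendsto_norm_zero_iff LIM_zero_iff)
  qed
  with s(1) show ?thesis by blast
qed

text \<open>The box has positive measure and so cannot lie in the exceptional null set.\<close>

lemma AE_imp_ex_in_scale_box:
  assumes "AE x in lebesgue. P (x :: 'a::euclidean_space)" "0 < s"
  shows "\<exists>x\<in>scale_box s. P x"
proof (rule ccontr)
  assume "\<not> (\<exists>x\<in>scale_box s. P x)"
  with assms(1) have "AE x in lebesgue. \<not> x \<in> (scale_box s :: 'a set)"
    by (auto elim!: eventually_mono)
  then have "emeasure lebesgue (scale_box s :: 'a set) = 0"
    by (subst (asm) AE_iff_measurable[where N = "scale_box s"]) auto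
  then show False
    using assms(2) by (simp add: emeasure_scale_box)
qed

section \<open>The closed infinite-dimensional subspace\<close>

definition step_space :: "real \<Rightarrow> real \<Rightarrow> 'd::finite L0 set" where
  "step_space p L = Lp p \<inter> range (\<lambda>a. abs_L0 (step L a))"

lemma subspace_step_space:
  assumes "2 \<le> L" "0 \<le> p"
  shows "L0.subspace (step_space p L :: 'd::finite L0 set)"
proof -
  have "L0.subspace (range (\<lambda>a. abs_L0 (step L a)) :: 'd L0 set)"
    unfolding L0.subspace_def
  proof (intro conjI ballI allI)
    have "step L (\<lambda>_. 0) = (\<lambda>_ :: real ^ 'd. 0)"
      by (simp add: step_def fun_eq_iff)
    then have "(0 :: 'd L0) = abs_L0 (step L (\<lambda>_. 0))"
      by (simp add: zero_L0_def)
    then show "(0 :: 'd L0) \<in> range (\<lambda>a. abs_L0 (step L a))"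
      by (rule range_eqI[where x = "\<lambda>_. 0"])
  next
    fix F G :: "'d L0"
    assume "F \<in> range (\<lambda>a. abs_L0 (step L a))" "G \<in> range (\<lambda>a. abs_L0 (step L a))"
    then obtain a b where FG: "F = abs_L0 (step L a)" "G = abs_L0 (step L b)" by blast
    moreover have "step L (\<lambda>n. a n + b n) = (\<lambda>x :: real ^ 'd. step L a x + step L b x)"
      by (rule ext, rule step_linear[OF assms(1)])
    ultimately have "F + G = abs_L0 (step L (\<lambda>n. a n + b n))"
      by (simp add: plus_L0.abs_eq ae_eq_self)
    then show "F + G \<in> range (\<lambda>a. abs_L0 (step L a))"
      by (rule range_eqI[where x = "\<lambda>n. a n + b n"])
  next
    fix c and F :: "'d L0"
    assume "F \<in> range (\<lambda>a. abs_L0 (step L a))"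
    then obtain a where "F = abs_L0 (step L a)" by blast
    moreover have "step L (\<lambda>n. c * a n) = (\<lambda>x :: real ^ 'd. c * step L a x)"
      by (rule ext, rule step_linear[OF assms(1)])
    ultimately have "scaleC_L0 c F = abs_L0 (step L (\<lambda>n. c * a n))"
      by (simp add: scaleC_L0.abs_eq ae_eq_self)
    then show "scaleC_L0 c F \<in> range (\<lambda>a. abs_L0 (step L a))"
      by (rule range_eqI[where x = "\<lambda>n. c * a n"])
  qed
  then show ?thesis
    unfolding step_space_def using assms(2) by (intro L0.subspace_inter subspace_Lp)
qed

text \<open>A subsequence converges almost everywhere. Step functions are constant on each box, so
  their coefficients converge too, and the limit is the step function with the limiting
  coefficients.\<close>

lemma closed_subspace_step_space:
  assumes L: "2 \<le> L" and p: "0 < p"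
  shows "closed_subspace_of (step_space p L :: 'd::finite L0 set) (Lp p) (Lp_norm p)"
  unfolding closed_subspace_of_def
proof (intro conjI allI impI; (elim conjE)?)
  show "step_space p L \<subseteq> (Lp p :: 'd L0 set)"
    by (auto simp: step_space_def)
  show "L0.subspace (step_space p L :: 'd L0 set)"
    using L p by (intro subspace_step_space) auto
  fix u and F :: "'d L0"
  assume u: "\<forall>k::nat. u k \<in> step_space p L" and F: "F \<in> Lp p" and lim: "(\<lambda>k. Lp_norm p (u k - F)) \<longlonglongrightarrow> 0"
  obtain f where f [measurable]: "f \<in> borel_measurable lebesgue" and F': "F = abs_L0 f" by (rule L0_cases)
  have "\<forall>k. \<exists>a. u k = abs_L0 (step L a)"
    using u by (auto simp: step_space_def)
  then obtain a where a: "\<And>k. u k = abs_L0 (step L (a k))"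
    by metis
  have "\<exists>s. strict_mono s \<and> (AE x in lebesgue. (\<lambda>k. step L (a (s k)) x) \<longlonglongrightarrow> f x)"
    using u F lim unfolding F' a
    by (intro Lp_tendsto_imp_AE_subseq[OF p]) (auto simp: step_space_def)
  then obtain s where AE: "AE x in lebesgue. (\<lambda>k. step L (a (s k)) x) \<longlonglongrightarrow> f x"
    by blast
  \<comment> \<open>One point of convergence in the n-th box is enough, since the value there is the
    n-th coefficient.\<close>
  have "\<exists>b. (\<lambda>k. a (s k) n) \<longlonglongrightarrow> b" for n
  proof -
    have "\<exists>x\<in>scale_box (1 / L ^ n). (\<lambda>k. step L (a (s k)) x) \<longlonglongrightarrow> f x"
      using L by (intro AE_imp_ex_in_scale_box[OF AE]) auto
    then obtain x where "x \<in> scale_box (1 / L ^ n)" "(\<lambda>k. step L (a (s k)) x) \<longlonglongrightarrow> f x"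
      by blast
    then show ?thesis
      using step_in[OF L, of x n] by auto
  qed
  then obtain b where b: "\<And>n. (\<lambda>k. a (s k) n) \<longlonglongrightarrow> b n"
    by metis
  have step: "(\<lambda>k. step L (a (s k)) x) \<longlonglongrightarrow> step L b x" for x :: "real ^ 'd"
  proof (cases "\<exists>n. x \<in> scale_box (1 / L ^ n)")
    case True
    then obtain n where "x \<in> scale_box (1 / L ^ n)" by blast
    from step_in[OF L this] b[of n] show ?thesis by simp
  qed (simp add: step_out)
  have "AE x in lebesgue. f x = step L b x"
    using AE by eventually_elim (rule LIMSEQ_unique[OF _ step])
  then have "F = abs_L0 (step L b)"
    by (simp add: F' abs_L0_eq_iff)
  with F show "F \<in> step_space p L"
    by (auto simp: step_space_def)
qed

text \<open>The normalized step \<open>e n\<close> is nonzero on the n-th box, whereas all other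
  \<open>e m\<close> lie in the subspace \<open>K n\<close> of classes vanishing there. Hence no
  \<open>e n\<close> is in the span of the others.\<close>

lemma infinite_dimensional_step_space:
  assumes L: "2 \<le> L"
  shows "infinite_dimensional (step_space p L :: 'd::finite L0 set)"
proof -
  define e :: "nat \<Rightarrow> 'd L0" where "e n = abs_L0 (step L (\<lambda>m. if m = n then 1 else 0))" for n
  define K :: "nat \<Rightarrow> 'd L0 set" where
    "K n = {abs_L0 f | f. f \<in> borel_measurable lebesgue \<and> (AE x in lebesgue. x \<in> scale_box (1 / L ^ n) \<longrightarrow> f x = 0)}" for n
  have K: "L0.subspace (K n)" for n
    unfolding L0.subspace_def
  proof (intro conjI ballI allI)
    show "0 \<in> K n"
      unfolding K_def zero_L0_def by force
  next
    fix F G assume "F \<in> K n" "G \<in> K n"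
    then obtain f g where [measurable]: "f \<in> borel_measurable lebesgue" "g \<in> borel_measurable lebesgue"
      and FG: "F = abs_L0 f" "G = abs_L0 g"
      and ae: "AE x in lebesgue. x \<in> scale_box (1 / L ^ n) \<longrightarrow> f x = 0"
        "AE x in lebesgue. x \<in> scale_box (1 / L ^ n) \<longrightarrow> g x = 0"
      by (auto simp: K_def)
    have "F + G = abs_L0 (\<lambda>x. f x + g x)"
      by (simp add: FG plus_L0.abs_eq ae_eq_self)
    moreover have "AE x in lebesgue. x \<in> scale_box (1 / L ^ n) \<longrightarrow> f x + g x = 0"
      using ae by eventually_elim simp
    moreover have "(\<lambda>x. f x + g x) \<in> borel_measurable lebesgue"
      by measurable
    ultimately show "F + G \<in> K n"
      unfolding K_def by blast
  next
    fix c F assume "F \<in> K n"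
    then obtain f where [measurable]: "f \<in> borel_measurable lebesgue"
      and F: "F = abs_L0 f"
      and ae: "AE x in lebesgue. x \<in> scale_box (1 / L ^ n) \<longrightarrow> f x = 0"
      by (auto simp: K_def)
    have "scaleC_L0 c F = abs_L0 (\<lambda>x. c * f x)"
      by (simp add: F scaleC_L0.abs_eq ae_eq_self)
    moreover have "AE x in lebesgue. x \<in> scale_box (1 / L ^ n) \<longrightarrow> c * f x = 0"
      using ae by eventually_elim simp
    moreover have "(\<lambda>x. c * f x) \<in> borel_measurable lebesgue"
      by measurable
    ultimately show "scaleC_L0 c F \<in> K n"
      unfolding K_def by blast
  qed
  have in_K: "e m \<in> K n" if "m \<noteq> n" for m n
  proof -
    have "AE x in lebesgue. x \<in> scale_box (1 / L ^ n) \<longrightarrow> step L (\<lambda>k. if k = m then 1 else 0) (x :: real ^ 'd) = 0"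
      using that by (intro AE_I2 impI) (simp add: step_in[OF L, where n = n])
    then show ?thesis
      unfolding K_def e_def using step_lebesgue by blast
  qed
  have not_in_K: "e n \<notin> K n" for n
  proof
    assume "e n \<in> K n"
    then obtain f where f: "f \<in> borel_measurable lebesgue" "e n = abs_L0 f"
      and ae: "AE x in lebesgue. x \<in> scale_box (1 / L ^ n) \<longrightarrow> f x = 0"
      by (auto simp: K_def)
    have "AE x in lebesgue. step L (\<lambda>m. if m = n then 1 else 0) x = f x"
      using f by (simp add: e_def abs_L0_eq_iff)
    with ae have "AE x in lebesgue. x \<in> scale_box (1 / L ^ n) \<longrightarrow> step L (\<lambda>m. if m = n then 1 else 0) (x :: real ^ 'd) = 0"
      by eventually_elim simp
    from AE_imp_ex_in_scale_box[OF this, of "1 / L ^ n"] obtain x :: "real ^ 'd"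
      where "x \<in> scale_box (1 / L ^ n)" "step L (\<lambda>m. if m = n then 1 else 0) x = 0"
      using L by auto
    then show False
      using step_in[OF L, of x n "\<lambda>m. if m = n then 1 else 0"] by simp
  qed
  have "inj e"
    using in_K not_in_K by (metis injI)
  then have inf: "infinite (range e)"
    using finite_imageD infinite_UNIV_nat by blast
  have ind: "L0.independent (range e)"
    unfolding L0.dependent_def
  proof safe
    fix n assume "e n \<in> L0.span (range e - {e n})"
    moreover have "range e - {e n} \<subseteq> K n"
    proof
      fix v assume "v \<in> range e - {e n}"
      then obtain m where "v = e m" "m \<noteq> n" by blast
      with in_K show "v \<in> K n" by simp
    qed
    ultimately show False
      using L0.span_minimal[OF _ K] not_in_K by blast
  qed
  have "e n \<in> Lp p" for n
  proof -
    have "(\<integral>\<^sup>+ x. ennreal (cmod (step L (\<lambda>m. if m = n then 1 else 0) (x :: real ^ 'd)) powr p) \<partial>lebesgue) =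
        (\<Sum>m. if m = n then ennreal ((1 / L ^ m) ^ CARD('d)) else 0)"
      unfolding nn_integral_step_powr[OF L] by (intro suminf_cong) simp
    also have "\<dots> = ennreal ((1 / L ^ n) ^ CARD('d))"
      using sums_single[of n "\<lambda>m. ennreal ((1 / L ^ m) ^ CARD('d))"] by (simp add: sums_iff)
    also have "\<dots> < \<infinity>" by simp
    finally show ?thesis
      by (simp add: e_def abs_L0_in_Lp_iff)
  qed
  then have "range e \<subseteq> step_space p L"
    by (auto simp: step_space_def e_def)
  then show ?thesis
    unfolding infinite_dimensional_def using L0.independent_span_bound[OF _ ind] inf by blast
qed

subsection \<open>The lower bound\<close>

text \<open>In the normalization by \<sigma>^n in space and r^(2 n) in frequency, the transform is a
  perturbed diagonal operator. The Lorentz integral dominates the p-th powers of its diagonal lower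
  bounds, and \<open>diagonal_perturbation\<close> recovers the norm of the coefficients.\<close>

lemma fourier_step_space_bounded_below:
  fixes p q L :: real
  assumes p: "1 < p" "p < 2" and pq: "1 / p + 1 / q = 1"
    and L: "2 \<le> L" and r_def: "r = L powr (- real CARD('d) / (2 * q))"
    and small: "r \<le> 1 / 4" "(2 * 4 ^ CARD('d)) powr p * (4 * r) \<le> 1 / 2"
    and F: "F \<in> (step_space p L :: 'd::finite L0 set)" and norm: "Lp_norm p F = 1"
  shows "F \<in> Lp 1"
    and "epowr (Lorentz_norm q p (fourier_L1 F)) p \<ge>
      ennreal (1 / (2 * (2 * 4 ^ CARD('d)) powr p * 2 powr (1 + p / q)))"
proof -
  define d where "d = CARD('d)"
  \<comment> \<open>From p < 2 follows 1 / q < 1 / 2 < 1 / p; this is the source of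
    \<open>\<sigma> \<le> r\<^sup>2\<close>.\<close>
  have q: "0 < q" and qp: "1 / q \<le> 1 / p"
  proof -
    have "1 / 2 < 1 / p" "1 / p < 1"
      using p by (auto simp: field_simps)
    then have "0 < 1 / q" "1 / q \<le> 1 / p"
      using pq by linarith+
    then show "0 < q" "1 / q \<le> 1 / p"
      by (auto simp: zero_less_divide_iff)
  qed
  obtain a where a: "F = abs_L0 (step L a)"
    using F by (auto simp: step_space_def)
  define \<sigma> where "\<sigma> = L powr (- real d / p)"
  have pos: "0 < \<sigma>" "0 < r"
    using L by (auto simp: \<sigma>_def r_def)
  have r2: "r\<^sup>2 = L powr (- real d / q)"
    using L by (simp add: r_def d_def powr_power power2_eq_square powr_add[symmetric] field_simps)
  have \<sigma>_le: "\<sigma> \<le> r\<^sup>2"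
    unfolding r2 \<sigma>_def using L qp mult_left_mono[OF qp, of "real d"] by (intro powr_mono) auto
  have "\<sigma> * r\<^sup>2 = L powr (- real d * (1 / p + 1 / q))"
    unfolding r2 \<sigma>_def powr_add[symmetric] by (simp add: algebra_simps)
  also have "\<dots> = (1 / L) ^ d"
    using L unfolding pq by (simp add: powr_minus powr_realpow power_divide field_simps)
  finally have prod: "\<sigma> * r\<^sup>2 = (1 / L) ^ d" .
  have \<sigma>_powr: "\<sigma> powr p = (1 / L) ^ d"
  proof -
    have "\<sigma> powr p = L powr (- real d)"
      using p by (simp add: \<sigma>_def powr_powr)
    then show ?thesis
      using L by (simp add: powr_minus powr_realpow power_divide field_simps)
  qed
  \<comment> \<open>The indicator of the n-th box has norm \<sigma>^n in \<open>Lp p\<close>, so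
    \<open>b\<close> holds the moduli of the normalized coefficients, and their p-th powers sum to
    1.\<close>
  define b where "b n = cmod (a n) * \<sigma> ^ n" for n
  have b0: "0 \<le> b n" for n
    using pos by (simp add: b_def)
  have b_powr: "cmod (a n) powr p * (1 / L ^ n) ^ d = b n powr p" for n
  proof -
    have "(\<sigma> ^ n) powr p = (\<sigma> powr p) ^ n"
      using pos by (simp add: powr_realpow[symmetric] powr_powr mult.commute)
    also have "\<dots> = (1 / L ^ n) ^ d"
      unfolding \<sigma>_powr by (simp add: power_divide power_mult[symmetric] mult.commute)
    finally show ?thesis
      using pos by (simp add: b_def powr_mult)
  qed
  have "(\<integral>\<^sup>+ x. ennreal (cmod (step L a (x :: real ^ 'd)) powr p) \<partial>lebesgue) = (\<Sum>n. ennreal (b n powr p))"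
    unfolding nn_integral_step_powr[OF L] b_powr[symmetric] by (simp add: d_def)
  moreover have "(\<integral>\<^sup>+ x. ennreal (cmod (step L a (x :: real ^ 'd)) powr p) \<partial>lebesgue) = epowr (Lp_norm p F) p"
    using p by (simp add: a Lp_norm_abs_L0 epowr_powr_inverse)
  moreover have "epowr 1 p = 1"
    using epowr_ennreal[of 1 p] by simp
  ultimately have suminf: "(\<Sum>n. ennreal (b n powr p)) = 1"
    using norm by simp
  have sum: "summable (\<lambda>n. b n powr p)"
    using suminf by (intro summable_suminf_not_top) auto
  have sum1: "(\<Sum>n. b n powr p) = 1"
    using suminf sum by (subst (asm) suminf_ennreal2) auto
  have b1: "b n \<le> 1" for n
    using le_suminf_powr[OF _ b0 sum, of n] p sum1 by simp
  have a_eq: "cmod (a n) * (1 / L ^ n) ^ d = b n * (r\<^sup>2) ^ n" for n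
  proof -
    have "(1 / L ^ n) ^ d = (\<sigma> * r\<^sup>2) ^ n"
      unfolding prod by (simp add: power_divide power_mult[symmetric] mult.commute)
    then show ?thesis
      by (simp add: b_def power_mult_distrib)
  qed
  have r2': "r\<^sup>2 < 1"
    using pos small(1) by (simp add: power_less_one_iff)
  \<comment> \<open>Since b_n \<le> 1, the series is dominated by the geometric series in
    \<open>r\<^sup>2\<close>.\<close>
  have suma: "summable (\<lambda>n. cmod (a n) * (1 / L ^ n) ^ CARD('d))"
    unfolding d_def[symmetric] a_eq
    by (rule summable_comparison_test'[OF summable_geometric[of "r\<^sup>2"], of 0])
      (use r2' b0 b1 in \<open>auto intro!: mult_left_le_one_le\<close>)
  have "(\<integral>\<^sup>+ x. ennreal (cmod (step L a (x :: real ^ 'd)) powr 1) \<partial>lebesgue) =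
      (\<Sum>n. ennreal (cmod (a n) * (1 / L ^ n) ^ CARD('d)))"
    unfolding nn_integral_step_powr[OF L] by simp
  also have "\<dots> < \<infinity>"
    unfolding infinity_ennreal_def less_top[symmetric]
    by (rule ennreal_suminf_neq_top[OF suma]) (use L in auto)
  finally show "F \<in> Lp 1"
    by (simp only: a abs_L0_in_Lp_iff step_lebesgue)

  define g where "g = fourier_integral (step L a :: real ^ 'd \<Rightarrow> complex)"
  have g: "g \<in> borel_measurable lebesgue" "fourier_L1 F = abs_L0 g"
    by (simp_all add: g_def fourier_integral_measurable a fourier_L1.abs_eq ae_eq_self)
  have p1: "1 \<le> p" and r0: "0 \<le> r"
    using p pos by auto
  note conv = off_diag_convolution_powr_le[OF p1 b0 sum r0 small(1)]
  define S where "S n = (\<Sum>m. (off_diag r n m)\<^sup>2 * b m)" for n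
  \<comment> \<open>The positive part is taken because \<open>Lorentz_integral_ge\<close> asks for
    nonnegative lower bounds.\<close>
  define G where "G n = max 0 (b n / 2 ^ d - 2 ^ d * S n)" for n
  have G_le: "G n * (r\<^sup>2) ^ n \<le> cmod (g \<xi>)" if "\<xi> \<in> scale_box (L ^ n)" for n \<xi>
  proof -
    have "b n / 2 ^ d - 2 ^ d * S n \<le> cmod (g \<xi>) / (r\<^sup>2) ^ n"
      using norm_fourier_step_ge[OF L pos \<sigma>_le prod[unfolded d_def] suma _ that] conv(1)[of n]
      by (simp add: b_def d_def g_def S_def)
    then have "G n \<le> cmod (g \<xi>) / (r\<^sup>2) ^ n"
      using pos by (simp add: G_def)
    then show ?thesis
      using pos by (simp add: pos_le_divide_eq)
  qed
  have t: "(L ^ n) ^ d = L ^ (n * d)" for n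
    by (simp add: power_mult)
  have d0: "0 < d" by (simp add: d_def)
  \<comment> \<open>The frequency box has volume L^(n d), whose power 1 / q cancels r^(2 n)
    exactly.\<close>
  have scaled: "((L ^ n) ^ d) powr (1 / q) * (G n * (r\<^sup>2) ^ n) = G n" for n
  proof -
    have "((L ^ n) ^ d) powr (1 / q) * (r\<^sup>2) ^ n = L powr (real (n * d) * (1 / q)) * L powr ((- real d / q) * real n)"
      using L unfolding t r2 by (simp add: powr_realpow[symmetric] powr_powr)
    also have "\<dots> = 1"
      using L unfolding powr_add[symmetric] by simp
    finally show ?thesis by (simp add: mult.left_commute)
  qed
  let ?J = "\<integral>\<^sup>+ s \<in> {0<..}. epowr (ennreal (s powr (1 / q)) * rearrangement (abs_L0 g) s) p * ennreal (1 / s) \<partial>lborel"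
  have J: "ennreal (2 powr (- 1 - p / q) * (\<Sum>n<N. G n powr p)) \<le> ?J" for N
  proof -
    have "ennreal (2 powr (- 1 - p / q) * (\<Sum>n<N. (((L ^ n) ^ d) powr (1 / q) * (G n * (r\<^sup>2) ^ n)) powr p)) \<le> ?J"
    proof (rule Lorentz_integral_ge[where A = "\<lambda>n. scale_box (L ^ n)", OF g(1) q])
      show "0 < (L ^ n) ^ d" for n
        using L by simp
      show "2 * (L ^ n) ^ d \<le> (L ^ Suc n) ^ d" for n
      proof -
        have "2 \<le> L ^ d"
          using L d0 self_le_power[of L d] by linarith
        then show ?thesis
          using L by (simp add: power_mult_distrib mult_right_mono)
      qed
      show "ennreal ((L ^ n) ^ d) \<le> emeasure lebesgue (scale_box (L ^ n) :: (real ^ 'd) set)" for n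
        using L by (simp add: emeasure_scale_box d_def)
    qed (use p pos G_le in \<open>auto simp: G_def\<close>)
    then show ?thesis
      unfolding scaled .
  qed
  have Lor: "epowr (Lorentz_norm q p (fourier_L1 F)) p = ?J"
    unfolding Lorentz_norm_def g(2) using p by (simp add: epowr_powr_inverse)
  let ?c = "(2 * 4 ^ d) powr p"
  have "ennreal (1 / (2 * ?c * 2 powr (1 + p / q))) \<le> ?J"
  \<comment> \<open>An infinite integral makes the claim trivial; a finite one is a real number and
    can bound the partial sums.\<close>
  proof (cases "?J = \<infinity>")
    case False
    define \<gamma> where "\<gamma> = enn2real ?J"
    have J': "?J = ennreal \<gamma>"
      unfolding \<gamma>_def using False by (simp add: less_top)
    have "(\<Sum>n<N. G n powr p) \<le> 2 powr (1 + p / q) * \<gamma>" for N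
    proof -
      have "2 powr (- 1 - p / q) * (\<Sum>n<N. G n powr p) \<le> \<gamma>"
        using J[of N] unfolding J' by (subst (asm) ennreal_le_iff) (auto simp: \<gamma>_def)
      then have "2 powr (1 + p / q) * (2 powr (- 1 - p / q) * (\<Sum>n<N. G n powr p)) \<le> 2 powr (1 + p / q) * \<gamma>"
        by (rule mult_left_mono) auto
      then show ?thesis
        unfolding mult.assoc[symmetric] powr_add[symmetric] by simp
    qed
    then have "(\<Sum>n. b n powr p) \<le> 2 * ?c * (2 powr (1 + p / q) * \<gamma>)"
    proof (rule diagonal_perturbation[OF p1 b0 sum r0 small(1), rotated 4])
      show "?c * (4 * r) \<le> 1 / 2"
        using small(2) by (simp add: d_def)
      \<comment> \<open>Solving the definition of \<open>G\<close> for b_n gives the coefficients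
        2^d and 4^d; the larger one is the constant C = 4^d of the perturbation lemma.\<close>
      show "b n \<le> 4 ^ d * (G n + (\<Sum>m. (off_diag r n m)\<^sup>2 * b m))" for n
      proof -
        have S0: "0 \<le> S n"
          unfolding S_def using conv(1) b0 by (intro suminf_nonneg) auto
        have four: "(4::real) ^ d = 2 ^ d * 2 ^ d"
          by (simp add: power_mult_distrib[symmetric])
        have "b n = 2 ^ d * (b n / 2 ^ d - 2 ^ d * S n) + 4 ^ d * S n"
          by (simp add: four right_diff_distrib)
        also have "\<dots> \<le> 2 ^ d * G n + 4 ^ d * S n"
          by (intro add_right_mono mult_left_mono) (auto simp: G_def)
        also have "\<dots> \<le> 4 ^ d * G n + 4 ^ d * S n"
          by (intro add_right_mono mult_right_mono power_mono) (auto simp: G_def)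
        finally show ?thesis
          by (simp add: S_def distrib_left)
      qed
    qed (auto simp: G_def)
    then have "1 / (2 * ?c * 2 powr (1 + p / q)) \<le> \<gamma>"
      unfolding sum1 by (subst pos_divide_le_eq) (auto simp: mult_ac)
    then show ?thesis
      unfolding J' by (rule ennreal_leI)
  qed simp
  then show "epowr (Lorentz_norm q p (fourier_L1 F)) p \<ge>
      ennreal (1 / (2 * (2 * 4 ^ CARD('d)) powr p * 2 powr (1 + p / q)))"
    unfolding Lor d_def .
qed

section \<open>Choice of the scale and conclusion\<close>

theorem theorem3p3:
  fixes p p' :: real and \<F> :: "'d::finite L0 \<Rightarrow> 'd L0"
  assumes "1 < p" and "p < 2" and "1 / p + 1 / p' = 1"
    and "is_fourier_operator p p' \<F>"
  shows "\<not> strictly_singular (Lp p) (Lp_norm p) (Lorentz_norm p' p) \<F>"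
proof
  assume sing: "strictly_singular (Lp p) (Lp_norm p) (Lorentz_norm p' p) \<F>"
  define d where "d = CARD('d)"
  have d0: "0 < d" by (simp add: d_def)
  have p': "0 < p'"
  proof -
    have "1 / p < 1"
      using assms(1) by (simp add: field_simps)
    then have "0 < 1 / p'"
      using assms(3) by linarith
    then show ?thesis
      by (simp add: zero_less_divide_iff)
  qed
  let ?c = "(2 * 4 ^ d) powr p :: real"
  \<comment> \<open>The two entries are the two smallness conditions on \<open>r\<close>: the bound
    1/4 and the condition \<open>?c * (4 * r) \<le> 1 / 2\<close>.\<close>
  define \<delta> where "\<delta> = min (1 / 4) (1 / (8 * ?c))"
  have \<delta>: "0 < \<delta>" by (simp add: \<delta>_def)
  \<comment> \<open>The second entry solves L^(-d / (2 p')) = \<delta>; the first keeps the boxes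
    disjoint.\<close>
  define L where "L = max 2 (\<delta> powr (- 2 * p' / d))"
  define r where "r = L powr (- real d / (2 * p'))"
  have L: "2 \<le> L" by (simp add: L_def)
  have "r \<le> (\<delta> powr (- 2 * p' / d)) powr (- real d / (2 * p'))"
    unfolding r_def using \<delta> d0 p' by (intro powr_mono2') (auto simp: L_def)
  also have "\<dots> = \<delta>"
    using \<delta> d0 p' by (simp add: powr_powr)
  finally have r: "r \<le> \<delta>" .
  then have small: "r \<le> 1 / 4" "?c * (4 * r) \<le> 1 / 2"
  proof -
    have "r \<le> 1 / (8 * ?c)" using r by (simp add: \<delta>_def)
    then have "?c * (4 * r) \<le> ?c * (4 * (1 / (8 * ?c)))"
      by (intro mult_left_mono) auto
    then show "?c * (4 * r) \<le> 1 / 2" by simp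
  qed (use r in \<open>simp add: \<delta>_def\<close>)
  define \<kappa> where "\<kappa> = 1 / (2 * ?c * 2 powr (1 + p / p'))"
  have \<kappa>: "0 < \<kappa>" by (simp add: \<kappa>_def)
  \<comment> \<open>Chosen so that \<epsilon>^p = \<kappa> / 2, strictly below the lower bound
    \<kappa> for the p-th power of the Lorentz norm.\<close>
  define \<epsilon> where "\<epsilon> = (\<kappa> / 2) powr (1 / p)"
  have "0 < \<epsilon>" using \<kappa> by (simp add: \<epsilon>_def)
  moreover have "closed_subspace_of (step_space p L :: 'd L0 set) (Lp p) (Lp_norm p)"
    using L assms(1) by (intro closed_subspace_step_space) auto
  moreover have "infinite_dimensional (step_space p L :: 'd L0 set)"
    using L by (rule infinite_dimensional_step_space)
  ultimately obtain F :: "'d L0" where F: "F \<in> step_space p L" "Lp_norm p F = 1"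
    and le: "Lorentz_norm p' p (\<F> F) \<le> ennreal \<epsilon>"
    using sing unfolding strictly_singular_def by blast
  note below = fourier_step_space_bounded_below[OF assms(1,2,3) L
      r_def[unfolded d_def] small(1) small(2)[unfolded d_def] F]
  \<comment> \<open>\<open>F\<close> lies in both \<open>Lp 1\<close> and \<open>Lp p\<close>, where
    the operator is given by the Fourier integral.\<close>
  have "\<F> F = fourier_L1 F"
    using assms(4) F(1) below(1) by (auto simp: is_fourier_operator_def step_space_def)
  then have "ennreal \<kappa> \<le> epowr (Lorentz_norm p' p (\<F> F)) p"
    using below(2) by (simp add: \<kappa>_def d_def)
  also have "\<dots> \<le> epowr (ennreal \<epsilon>) p"
    using le assms(1) by (intro epowr_mono) auto
  also have "\<dots> = ennreal (\<kappa> / 2)"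
    using \<kappa> assms(1) by (simp add: \<epsilon>_def epowr_ennreal powr_powr)
  finally show False
    using \<kappa> by simp
qed

end
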